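(* Let $d\in\{2,3,\dots\}\cup\{\infty\}$, and let $(\mathbf b,\mathbf n=(n_j)_{j=1}^d)$ be a pair of weight and frequency data of length $d$. Then the multiplier variety $V$ associated with the kernel $K_{\mathbf b,\mathbf n}$ is equal to $\mathbb B_d$ if and only if the set $\{\ln n_j:j=1,\dots,d\}$ is linearly independent over $\mathbb Q$.
   Context: For $d=\infty$ the index set $\{1,\dots,d\}$ means $\mathbb N=\{1,2,\dots\}$ and $\mathbb C^d$ means the Hilbert space of square-summable sequences. $\mathbb B_d$ is the open unit ball of $\mathbb C^d$, and $\mathbb H_\rho=\{s\in\mathbb C:\operatorname{Re}(s)>\rho\}$. A pair $(\mathbf b,\mathbf n)$ of weight and frequency data of length $d$ consists of a $d$-tuple $\mathbf b=(b_j)_{j=1}^d$ of positive reals and a $d$-tuple $\mathbf n=(n_j)_{j=1}^d$ of distinct integers $\ge2$; if $d=\infty$ it is always assumed that $\sigma_a(\sum_jb_jn_j^{-s})<\infty$, where $\sigma_a$ is the abscissa of absolute convergence of a Dirichlet series. Choose $\rho\in\mathbb R$ such that $\sum_jb_jn_j^{-2\operatorname{Re}(s)}<1$ for all $s\in\mathbb H_\rho$. The associated kernel is $K_{\mathbf b,\mathbf n}(s,u)=\dfrac1{1-\sum_{j=1}^db_jn_j^{-s-\overline u}}$ on $\mathbb H_\rho\times\mathbb H_\rho$, and $f_{\mathbf b,\mathbf n}:\mathbb H_\rho\to\mathbb B_d$ is $f_{\mathbf b,\mathbf n}(s)=(\sqrt{b_j}\,n_j^{-s})_{j=1}^d$.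 $\mathcal M_d$ is the multiplier algebra of the Drury–Arveson space $H^2_d$, the reproducing kernel Hilbert space on $\mathbb B_d$ with kernel $1/(1-\langle\mathbf z,\mathbf w\rangle)$. The multiplier variety associated with $K_{\mathbf b,\mathbf n}$ is $$V=\{\mathbf z\in\mathbb B_d:g(\mathbf z)=0\text{ for all }g\in\mathcal M_d\text{ with }g|_{f_{\mathbf b,\mathbf n}(\mathbb H_\rho)}\equiv0\}.$$ *)

theory Defs
  imports "HOL-Analysis.Analysis" "HOL-Library.Extended_Nat"
begin

subsection \<open>Reproducing kernel Hilbert spaces and multipliers\<close>

text \<open>A complex-valued function on a set \<open>X\<close> is represented by a total function that is \<open>0\<close>
  outside \<open>X\<close>.\<close>

definition functions_on :: "'x set \<Rightarrow> ('x \<Rightarrow> complex) set" where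
  "functions_on X = {f. \<forall>x. x \<notin> X \<longrightarrow> f x = 0}"

definition kernel_fun :: "'x set \<Rightarrow> ('x \<Rightarrow> 'x \<Rightarrow> complex) \<Rightarrow> 'x \<Rightarrow> 'x \<Rightarrow> complex" where
  "kernel_fun X K y = (\<lambda>x. if x \<in> X then K x y else 0)"

definition is_inner_product ::
    "('x \<Rightarrow> complex) set \<Rightarrow> (('x \<Rightarrow> complex) \<Rightarrow> ('x \<Rightarrow> complex) \<Rightarrow> complex) \<Rightarrow> bool" where
  "is_inner_product H ip \<longleftrightarrow>
     (\<forall>f\<in>H. \<forall>g\<in>H. \<forall>h\<in>H. ip (\<lambda>x. f x + g x) h = ip f h + ip g h) \<and>
     (\<forall>c. \<forall>f\<in>H. \<forall>g\<in>H. ip (\<lambda>x. c * f x) g = c * ip f g) \<and>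
     (\<forall>f\<in>H. \<forall>g\<in>H. ip g f = cnj (ip f g)) \<and>
     (\<forall>f\<in>H. ip f f \<in> \<real> \<and> 0 \<le> Re (ip f f)) \<and>
     (\<forall>f\<in>H. ip f f = 0 \<longrightarrow> f = (\<lambda>x. 0))"

definition ip_dist ::
    "(('x \<Rightarrow> complex) \<Rightarrow> ('x \<Rightarrow> complex) \<Rightarrow> complex) \<Rightarrow> ('x \<Rightarrow> complex) \<Rightarrow> ('x \<Rightarrow> complex) \<Rightarrow> real" where
  "ip_dist ip f g = sqrt (Re (ip (\<lambda>x. f x - g x) (\<lambda>x. f x - g x)))"

definition is_rkhs ::
    "'x set \<Rightarrow> ('x \<Rightarrow> 'x \<Rightarrow> complex) \<Rightarrow> ('x \<Rightarrow> complex) set \<Rightarrow>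
     (('x \<Rightarrow> complex) \<Rightarrow> ('x \<Rightarrow> complex) \<Rightarrow> complex) \<Rightarrow> bool" where
  "is_rkhs X K H ip \<longleftrightarrow>
     H \<subseteq> functions_on X \<and>
     (\<lambda>x. 0) \<in> H \<and>
     (\<forall>f\<in>H. \<forall>g\<in>H. (\<lambda>x. f x + g x) \<in> H) \<and>
     (\<forall>c. \<forall>f\<in>H. (\<lambda>x. c * f x) \<in> H) \<and>
     is_inner_product H ip \<and>
     (\<forall>F. (\<forall>i::nat. F i \<in> H) \<and>
          (\<forall>e>0. \<exists>N. \<forall>i\<ge>N. \<forall>k\<ge>N. ip_dist ip (F i) (F k) < e) \<longrightarrow>
          (\<exists>f\<in>H. (\<lambda>i. ip_dist ip (F i) f) \<longlonglongrightarrow> 0)) \<and>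
     (\<forall>y\<in>X. kernel_fun X K y \<in> H) \<and>
     (\<forall>f\<in>H. \<forall>y\<in>X. ip f (kernel_fun X K y) = f y)"

text \<open>Nothing depends on the choice: by the Moore--Aronszajn theorem a positive
  semidefinite kernel \<open>K\<close> on \<open>X\<close> has exactly one reproducing kernel Hilbert space.\<close>

definition rkhs :: "'x set \<Rightarrow> ('x \<Rightarrow> 'x \<Rightarrow> complex) \<Rightarrow> ('x \<Rightarrow> complex) set" where
  "rkhs X K = (SOME H. \<exists>ip. is_rkhs X K H ip)"

definition multiplier_algebra :: "'x set \<Rightarrow> ('x \<Rightarrow> complex) set \<Rightarrow> ('x \<Rightarrow> complex) set" where
  "multiplier_algebra X H = {g \<in> functions_on X. \<forall>f\<in>H. (\<lambda>x. g x * f x) \<in> H}"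

subsection \<open>The Drury--Arveson space\<close>

definition index_set :: "enat \<Rightarrow> nat set" where
  "index_set d = {j. 1 \<le> j \<and> enat j \<le> d}"

text \<open>The space $\mathbb{C}^d$ (square-summable sequences for \<open>d = \<infinity>\<close>) consists of sequences
  that vanish outside the index set; summability is automatic for finite \<open>d\<close>.\<close>

definition complex_space :: "enat \<Rightarrow> (nat \<Rightarrow> complex) set" where
  "complex_space d =
     {z. (\<forall>j. j \<notin> index_set d \<longrightarrow> z j = 0) \<and> (\<lambda>j. (cmod (z j))\<^sup>2) summable_on index_set d}"

definition cinner_d :: "enat \<Rightarrow> (nat \<Rightarrow> complex) \<Rightarrow> (nat \<Rightarrow> complex) \<Rightarrow> complex" where
  "cinner_d d z w = (\<Sum>\<^sub>\<infinity>j\<in>index_set d. z j * cnj (w j))"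

definition unit_ball :: "enat \<Rightarrow> (nat \<Rightarrow> complex) set" where
  "unit_ball d = {z \<in> complex_space d. (\<Sum>\<^sub>\<infinity>j\<in>index_set d. (cmod (z j))\<^sup>2) < 1}"

definition drury_arveson_kernel :: "enat \<Rightarrow> (nat \<Rightarrow> complex) \<Rightarrow> (nat \<Rightarrow> complex) \<Rightarrow> complex" where
  "drury_arveson_kernel d z w = 1 / (1 - cinner_d d z w)"

definition drury_arveson_space :: "enat \<Rightarrow> ((nat \<Rightarrow> complex) \<Rightarrow> complex) set" where
  "drury_arveson_space d = rkhs (unit_ball d) (drury_arveson_kernel d)"

definition drury_arveson_multipliers :: "enat \<Rightarrow> ((nat \<Rightarrow> complex) \<Rightarrow> complex) set" where
  "drury_arveson_multipliers d = multiplier_algebra (unit_ball d) (drury_arveson_space d)"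

subsection \<open>Weight and frequency data\<close>

definition abs_conv_abscissa :: "enat \<Rightarrow> (nat \<Rightarrow> real) \<Rightarrow> (nat \<Rightarrow> nat) \<Rightarrow> ereal" where
  "abs_conv_abscissa d b n =
     (INF s \<in> {s. (\<lambda>j. cmod (of_real (b j) * of_nat (n j) powr (- s))) summable_on index_set d}.
        ereal (Re s))"

definition weight_frequency_data :: "enat \<Rightarrow> (nat \<Rightarrow> real) \<Rightarrow> (nat \<Rightarrow> nat) \<Rightarrow> bool" where
  "weight_frequency_data d b n \<longleftrightarrow>
     (\<forall>j\<in>index_set d. 0 < b j) \<and>
     (\<forall>j\<in>index_set d. 2 \<le> n j) \<and>
     inj_on n (index_set d) \<and>
     (d = \<infinity> \<longrightarrow> abs_conv_abscissa d b n < \<infinity>)"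

definition half_plane :: "real \<Rightarrow> complex set" where
  "half_plane \<rho> = {s. \<rho> < Re s}"

text \<open>Convergence of the series is stated explicitly because a divergent sum has the value \<open>0\<close>.\<close>

definition admissible_abscissa :: "enat \<Rightarrow> (nat \<Rightarrow> real) \<Rightarrow> (nat \<Rightarrow> nat) \<Rightarrow> real \<Rightarrow> bool" where
  "admissible_abscissa d b n \<rho> \<longleftrightarrow>
     (\<forall>s\<in>half_plane \<rho>.
        (\<lambda>j. b j * real (n j) powr (- 2 * Re s)) summable_on index_set d \<and>
        (\<Sum>\<^sub>\<infinity>j\<in>index_set d. b j * real (n j) powr (- 2 * Re s)) < 1)"

definition dirichlet_kernel ::
    "enat \<Rightarrow> (nat \<Rightarrow> real) \<Rightarrow> (nat \<Rightarrow> nat) \<Rightarrow> complex \<Rightarrow> complex \<Rightarrow> complex" where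
  "dirichlet_kernel d b n s u =
     1 / (1 - (\<Sum>\<^sub>\<infinity>j\<in>index_set d. of_real (b j) * of_nat (n j) powr (- s - cnj u)))"

definition embedding :: "enat \<Rightarrow> (nat \<Rightarrow> real) \<Rightarrow> (nat \<Rightarrow> nat) \<Rightarrow> complex \<Rightarrow> nat \<Rightarrow> complex" where
  "embedding d b n s =
     (\<lambda>j. if j \<in> index_set d then of_real (sqrt (b j)) * of_nat (n j) powr (- s) else 0)"

text \<open>The kernel enters the multiplier variety only through the embedding, which pulls the
  Drury--Arveson kernel back to it.\<close>

lemma dirichlet_kernel_eq:
  assumes "weight_frequency_data d b n"
  shows "dirichlet_kernel d b n s u =
           drury_arveson_kernel d (embedding d b n s) (embedding d b n u)"
proof -
  have "of_real (b j) * of_nat (n j) powr (- s - cnj u) =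
          embedding d b n s j * cnj (embedding d b n u j)" if j: "j \<in> index_set d" for j
  proof -
    have "0 < b j" "2 \<le> n j"
      using assms j by (auto simp: weight_frequency_data_def)
    then have b: "complex_of_real (sqrt (b j)) * of_real (sqrt (b j)) = of_real (b j)"
      by (simp flip: of_real_mult)
    have "cnj (of_nat (n j) powr (- u)) = of_nat (n j) powr (- cnj u)"
      using \<open>2 \<le> n j\<close> by (simp add: powr_def exp_cnj cnj_Ln)
    then have "embedding d b n s j * cnj (embedding d b n u j) =
        (of_real (sqrt (b j)) * of_real (sqrt (b j))) *
        (of_nat (n j) powr (- s) * of_nat (n j) powr (- cnj u))"
      using j by (simp add: embedding_def)
    also have "\<dots> = of_real (b j) * of_nat (n j) powr (- s - cnj u)"
      unfolding b by (simp flip: powr_add)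
    finally show ?thesis by simp
  qed
  then show ?thesis
    by (simp add: dirichlet_kernel_def drury_arveson_kernel_def cinner_d_def cong: infsum_cong)
qed

definition multiplier_variety ::
    "enat \<Rightarrow> (nat \<Rightarrow> real) \<Rightarrow> (nat \<Rightarrow> nat) \<Rightarrow> real \<Rightarrow> (nat \<Rightarrow> complex) set" where
  "multiplier_variety d b n \<rho> =
     {z \<in> unit_ball d. \<forall>g \<in> drury_arveson_multipliers d.
        (\<forall>w \<in> embedding d b n ` half_plane \<rho>. g w = 0) \<longrightarrow> g z = 0}"

end

theory Submission
  imports Defs "HOL-Combinatorics.Multiset_Permutations"
begin

text \<open>Every function in the Drury--Arveson space has a unique expansion in monomials
  $\mathbf z^\alpha$. At the points $f_{\mathbf b,\mathbf n}(s)$ the expansion becomes an absolutely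
  convergent Dirichlet series whose frequencies are the integers $\prod_j n_j^{\alpha_j}$. These are
  pairwise distinct exactly when the numbers $\ln n_j$ are linearly independent over the rationals.
  If they are distinct, a multiplier (which lies in the space, because constants do) vanishing on the
  image has only zero coefficients. If two multi-indices give the same integer, the difference of
  the two monomials, suitably normalized, is a nonzero multiplier vanishing on the image.\<close>

subsection \<open>Uniqueness of reproducing kernel Hilbert spaces\<close>

text \<open>\<open>rkhs\<close> is an unspecified choice, so nothing is known about the members of
  the Drury-Arveson space until a concrete model is shown to be a reproducing kernel space and any
  two such spaces are shown to coincide. The model consists of the square-summable combinations of
  normalized monomials. It inherits the inner product of the coefficients only if a function
  determines its coefficients, and for \<open>d = \<infinity>\<close> this is a statement about
  power series in infinitely many variables. It is obtained from Dirichlet series as well: along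
  points with coordinates p_j / n_j^k, k = 0, 1, 2, ..., an expansion becomes a series in k whose
  coefficients are detected from the smallest frequency upwards. One lemma thus serves twice: with
  primes as n_j it makes the model well defined, and with the given frequencies at the points rho +
  1 + k it yields one half of the theorem, so only countably many real points of the half-plane
  enter. For the other half it is enough that coordinates are multipliers; that the binomial is not
  the zero function is again uniqueness of coefficients.\<close>

locale reproducing_space =
  fixes X :: "'x set" and K :: "'x \<Rightarrow> 'x \<Rightarrow> complex" and H :: "('x \<Rightarrow> complex) set"
    and ip :: "('x \<Rightarrow> complex) \<Rightarrow> ('x \<Rightarrow> complex) \<Rightarrow> complex"
  assumes is_rkhs: "is_rkhs X K H ip"
begin

abbreviation nsq :: "('x \<Rightarrow> complex) \<Rightarrow> real" where
  "nsq f \<equiv> Re (ip f f)"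

lemma outside: "f \<in> H \<Longrightarrow> x \<notin> X \<Longrightarrow> f x = 0"
  using is_rkhs by (auto simp: is_rkhs_def functions_on_def)

lemma zero_mem: "(\<lambda>x. 0) \<in> H"
  using is_rkhs by (auto simp: is_rkhs_def)

lemma add_mem: "f \<in> H \<Longrightarrow> g \<in> H \<Longrightarrow> (\<lambda>x. f x + g x) \<in> H"
  using is_rkhs by (auto simp: is_rkhs_def)

lemma scale_mem: "f \<in> H \<Longrightarrow> (\<lambda>x. c * f x) \<in> H"
  using is_rkhs by (auto simp: is_rkhs_def)

lemma diff_mem: "f \<in> H \<Longrightarrow> g \<in> H \<Longrightarrow> (\<lambda>x. f x - g x) \<in> H"
  using add_mem[OF _ scale_mem[of g "-1"]] by simp

lemma kernel_mem: "y \<in> X \<Longrightarrow> kernel_fun X K y \<in> H"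
  using is_rkhs by (auto simp: is_rkhs_def)

lemma reproducing: "f \<in> H \<Longrightarrow> y \<in> X \<Longrightarrow> ip f (kernel_fun X K y) = f y"
  using is_rkhs by (auto simp: is_rkhs_def)

lemma complete:
  assumes "\<And>i::nat. F i \<in> H"
    and "\<And>e. e > 0 \<Longrightarrow> \<exists>N. \<forall>i\<ge>N. \<forall>k\<ge>N. ip_dist ip (F i) (F k) < e"
  obtains f where "f \<in> H" "(\<lambda>i. ip_dist ip (F i) f) \<longlonglongrightarrow> 0"
  using is_rkhs assms unfolding is_rkhs_def by blast

lemma inner_product: "is_inner_product H ip"
  using is_rkhs by (auto simp: is_rkhs_def)

lemma ip_add_left: "f \<in> H \<Longrightarrow> g \<in> H \<Longrightarrow> h \<in> H \<Longrightarrow> ip (\<lambda>x. f x + g x) h = ip f h + ip g h"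
  using inner_product unfolding is_inner_product_def by blast

lemma ip_scale_left: "f \<in> H \<Longrightarrow> g \<in> H \<Longrightarrow> ip (\<lambda>x. c * f x) g = c * ip f g"
  using inner_product unfolding is_inner_product_def by blast

lemma ip_cnj: "f \<in> H \<Longrightarrow> g \<in> H \<Longrightarrow> ip g f = cnj (ip f g)"
  using inner_product unfolding is_inner_product_def by blast

lemma ip_add_right: "f \<in> H \<Longrightarrow> g \<in> H \<Longrightarrow> h \<in> H \<Longrightarrow> ip h (\<lambda>x. f x + g x) = ip h f + ip h g"
  using ip_cnj[of h "\<lambda>x. f x + g x"] ip_cnj[of h f] ip_cnj[of h g] ip_cnj[of "\<lambda>x. f x + g x" h]
  by (simp add: ip_add_left add_mem)

lemma ip_scale_right: "f \<in> H \<Longrightarrow> g \<in> H \<Longrightarrow> ip f (\<lambda>x. c * g x) = cnj c * ip f g"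
  using ip_cnj[of "\<lambda>x. c * g x" f] ip_cnj[of g f]
  by (simp add: ip_scale_left scale_mem)

lemma nsq_nonneg: "f \<in> H \<Longrightarrow> 0 \<le> nsq f"
  using inner_product unfolding is_inner_product_def by blast

lemma ip_self: "f \<in> H \<Longrightarrow> ip f f = of_real (nsq f)"
  using inner_product unfolding is_inner_product_def by (metis of_real_Re)

lemma nsq_scale:
  assumes f: "f \<in> H"
  shows "nsq (\<lambda>x. c * f x) = (cmod c)\<^sup>2 * nsq f"
proof -
  have "ip (\<lambda>x. c * f x) (\<lambda>x. c * f x) = (c * cnj c) * ip f f"
    by (simp add: ip_scale_left ip_scale_right scale_mem f)
  also have "\<dots> = of_real ((cmod c)\<^sup>2 * nsq f)"
    using ip_self[OF f] complex_norm_square[of c] by (metis of_real_mult of_real_power)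
  finally show ?thesis
    by simp
qed

lemma nsq_add: 
  assumes "f \<in> H" "g \<in> H"
  shows "nsq (\<lambda>x. f x + g x) = nsq f + 2 * Re (ip f g) + nsq g"
  using assms ip_cnj[OF assms] by (simp add: ip_add_left ip_add_right add_mem)

lemma parallelogram:
  assumes f: "f \<in> H" and g: "g \<in> H"
  shows "nsq (\<lambda>x. f x - g x) + nsq (\<lambda>x. f x + g x) = 2 * nsq f + 2 * nsq g"
  using nsq_add[OF f g] nsq_add[OF f scale_mem[OF g, of "-1"]]
    ip_scale_right[OF f g, of "-1"] nsq_scale[OF g, of "-1"]
  by simp

text \<open>Moving from \<open>m\<close> along the kernel function at \<open>y\<close> decreases the norm by an amount
  controlled by \<open>m y\<close>; with \<open>\<delta> = 0\<close> this is the boundedness of point evaluations, and with \<open>\<delta>\<close>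
  the squared distance to a subspace it shows that minimizing sequences converge pointwise.\<close>
lemma point_bound:
  assumes m: "m \<in> H" and y: "y \<in> X"
    and \<delta>: "\<And>c. \<delta> \<le> nsq (\<lambda>x. m x + c * kernel_fun X K y x)"
  shows "(cmod (m y))\<^sup>2 \<le> (nsq (kernel_fun X K y) + 1) * (nsq m - \<delta>)"
proof -
  let ?k = "kernel_fun X K y"
  define \<kappa> where "\<kappa> = nsq ?k"
  \<comment> \<open>With \<open>c = - t * m y\<close>, the value \<open>1 / \<kappa>\<close> would
    give the shortest vector. Adding 1 keeps \<open>t\<close> meaningful for
    \<open>\<kappa> = 0\<close> and still ensures \<open>t * \<kappa> \<le> 1\<close>.\<close>
  define t where "t = 1 / (\<kappa> + 1)"
  have \<kappa>: "\<kappa> \<ge> 0"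
    using nsq_nonneg[OF kernel_mem[OF y]] by (simp add: \<kappa>_def)
  define c where "c = - of_real t * m y"
  have sq: "(cmod c)\<^sup>2 = t\<^sup>2 * (cmod (m y))\<^sup>2"
    by (simp add: c_def norm_mult power_mult_distrib)
  have "Re (ip m (\<lambda>x. c * ?k x)) = Re (cnj c * m y)"
    using m y by (simp add: ip_scale_right kernel_mem reproducing)
  also have "\<dots> = - t * (cmod (m y))\<^sup>2"
    unfolding c_def cmod_power2 by (simp add: power2_eq_square algebra_simps)
  finally have "nsq (\<lambda>x. m x + c * ?k x) = nsq m - 2 * t * (cmod (m y))\<^sup>2 + t\<^sup>2 * (cmod (m y))\<^sup>2 * \<kappa>"
    using nsq_add[OF m scale_mem[OF kernel_mem[OF y], of c]] nsq_scale[OF kernel_mem[OF y], of c]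
    by (simp add: sq \<kappa>_def)
  with \<delta>[of c] have "(cmod (m y))\<^sup>2 * (2 * t - t * (t * \<kappa>)) \<le> nsq m - \<delta>"
    by (simp add: algebra_simps power2_eq_square)
  moreover have "t * (t * \<kappa>) \<le> t * 1"
    using \<kappa> by (intro mult_left_mono) (auto simp: t_def field_simps)
  then have "(cmod (m y))\<^sup>2 * t \<le> (cmod (m y))\<^sup>2 * (2 * t - t * (t * \<kappa>))"
    by (intro mult_left_mono) auto
  ultimately have "(cmod (m y))\<^sup>2 * t \<le> nsq m - \<delta>"
    by linarith
  then show ?thesis
    using \<kappa> by (simp add: t_def field_simps \<kappa>_def)
qed

lemma tendsto_pointwise:
  assumes F: "\<And>i::nat. F i \<in> H" and h: "h \<in> H" and lim: "(\<lambda>i. ip_dist ip (F i) h) \<longlonglongrightarrow> 0"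
    and y: "y \<in> X"
  shows "(\<lambda>i. F i y) \<longlonglongrightarrow> h y"
proof -
  let ?C = "nsq (kernel_fun X K y) + 1"
  have "(cmod (F i y - h y))\<^sup>2 \<le> ?C * (ip_dist ip (F i) h)\<^sup>2" for i
    using point_bound[OF diff_mem[OF F h] y, of 0]
    by (simp add: ip_dist_def nsq_nonneg diff_mem add_mem scale_mem kernel_mem F h y)
  moreover have "(\<lambda>i. ?C * (ip_dist ip (F i) h)\<^sup>2) \<longlonglongrightarrow> ?C * 0\<^sup>2"
    by (intro tendsto_intros lim)
  ultimately have "(\<lambda>i. (cmod (F i y - h y))\<^sup>2) \<longlonglongrightarrow> 0"
    by (rule_tac Lim_null_comparison[OF always_eventually, where g = "\<lambda>i. ?C * (ip_dist ip (F i) h)\<^sup>2"]) simp_all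
  from tendsto_real_sqrt[OF this] have "(\<lambda>i. cmod (F i y - h y)) \<longlonglongrightarrow> 0"
    by simp
  then show ?thesis
    by (rule LIM_zero_cancel[OF tendsto_norm_zero_cancel])
qed

end

section \<open>Approximation by finite combinations of kernel functions\<close>

text \<open>This linear span depends on \<open>X\<close> and \<open>K\<close> alone, so it lies in
  every space with kernel \<open>K\<close> and lets two of them be compared. Generating it one term
  at a time makes induction over its members available.\<close>

inductive_set kernel_span :: "'x set \<Rightarrow> ('x \<Rightarrow> 'x \<Rightarrow> complex) \<Rightarrow> ('x \<Rightarrow> complex) set"
  for X K where
  zero: "(\<lambda>x. 0) \<in> kernel_span X K"
| step: "f \<in> kernel_span X K \<Longrightarrow> y \<in> X \<Longrightarrow>
           (\<lambda>x. f x + c * kernel_fun X K y x) \<in> kernel_span X K"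

lemma kernel_span_add:
  assumes "g \<in> kernel_span X K" "f \<in> kernel_span X K"
  shows "(\<lambda>x. f x + g x) \<in> kernel_span X K"
  using assms
proof induction
  case (step g y c)
  then show ?case
    using kernel_span.step[of "\<lambda>x. f x + g x" X K y c] by (simp add: add.assoc)
qed simp

lemma kernel_span_scale:
  assumes "f \<in> kernel_span X K"
  shows "(\<lambda>x. a * f x) \<in> kernel_span X K"
  using assms
proof induction
  case (step f y c)
  then show ?case
    using kernel_span.step[of "\<lambda>x. a * f x" X K y "a * c"] by (simp add: algebra_simps)
qed (simp add: kernel_span.zero)

context reproducing_space
begin

lemma kernel_span_subset: "f \<in> kernel_span X K \<Longrightarrow> f \<in> H"
  by (induction rule: kernel_span.induct) (simp_all add: zero_mem add_mem scale_mem kernel_mem)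

text \<open>The sequence minimizes the distance from \<open>f\<close> to the span. The parallelogram
  law makes it Cauchy, and \<open>point_bound\<close> makes the residuals tend to 0 at every point.
  Pointwise convergence is all that the comparison of two spaces requires, so no orthogonal
  projection is constructed.\<close>

lemma kernel_span_approx:
  assumes f: "f \<in> H"
  obtains F where "\<And>i::nat. F i \<in> kernel_span X K"
    "\<And>e. e > 0 \<Longrightarrow> \<exists>N. \<forall>i\<ge>N. \<forall>k\<ge>N. ip_dist ip (F i) (F k) < e"
    "\<And>y. y \<in> X \<Longrightarrow> (\<lambda>i. F i y) \<longlonglongrightarrow> f y"
proof -
  define D where "D g = nsq (\<lambda>x. f x - g x)" for g
  define \<delta> where "\<delta> = (INF g \<in> kernel_span X K. D g)"
  have bdd: "bdd_below (D ` kernel_span X K)"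
    by (rule bdd_belowI2[of _ 0]) (simp add: D_def nsq_nonneg diff_mem f kernel_span_subset)
  have lower: "\<delta> \<le> D g" if "g \<in> kernel_span X K" for g
    unfolding \<delta>_def by (rule cINF_lower[OF bdd that])
  have "\<exists>g\<in>kernel_span X K. D g < \<delta> + inverse (real (Suc i))" for i
    using cINF_less_iff[OF _ bdd, of "\<delta> + inverse (real (Suc i))"] kernel_span.zero
    unfolding \<delta>_def by auto
  then obtain F where F: "\<And>i. F i \<in> kernel_span X K" and DF: "\<And>i. D (F i) < \<delta> + inverse (real (Suc i))"
    by metis
  have FH: "F i \<in> H" for i
    by (rule kernel_span_subset[OF F])
  have cauchy: "nsq (\<lambda>x. F i x - F k x) \<le> 2 * inverse (real (Suc i)) + 2 * inverse (real (Suc k))" for i k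
  proof -
    \<comment> \<open>The midpoint stays in the span, so its squared distance to \<open>f\<close> is
      at least \<open>\<delta>\<close>; the parallelogram law then forces two near-minimizers to be
      close to each other.\<close>
    let ?mid = "\<lambda>x. (1/2) * (F i x + F k x)"
    have mid: "?mid \<in> kernel_span X K"
      by (rule kernel_span_scale[OF kernel_span_add[OF F F]])
    have "nsq (\<lambda>x. (f x - F k x) + (f x - F i x)) = nsq (\<lambda>x. 2 * (f x - ?mid x))"
      by (simp add: algebra_simps)
    also have "\<dots> = 4 * D ?mid"
      unfolding D_def by (subst nsq_scale[OF diff_mem[OF f kernel_span_subset[OF mid]]]) simp
    finally have "nsq (\<lambda>x. F i x - F k x) + 4 * D ?mid = 2 * D (F k) + 2 * D (F i)"
      using parallelogram[OF diff_mem[OF f FH[of k]] diff_mem[OF f FH[of i]]]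
      by (simp add: D_def algebra_simps)
    with lower[OF mid] DF[of i] DF[of k] show ?thesis
      by linarith
  qed
  show ?thesis
  proof (rule that[of F])
    show "F i \<in> kernel_span X K" for i
      by (rule F)
  next
    fix e :: real assume "e > 0"
    then obtain N where N: "inverse (real (Suc N)) < e\<^sup>2 / 4"
      using reals_Archimedean[of "e\<^sup>2 / 4"] by auto
    have "ip_dist ip (F i) (F k) < e" if "i \<ge> N" "k \<ge> N" for i k
    proof -
      have "inverse (real (Suc i)) \<le> inverse (real (Suc N))" "inverse (real (Suc k)) \<le> inverse (real (Suc N))"
        using that by (auto simp: field_simps)
      with cauchy[of i k] N have "nsq (\<lambda>x. F i x - F k x) < e\<^sup>2"
        by linarith
      then show ?thesis
        using \<open>e > 0\<close> by (simp add: ip_dist_def real_less_lsqrt)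
    qed
    then show "\<exists>N. \<forall>i\<ge>N. \<forall>k\<ge>N. ip_dist ip (F i) (F k) < e"
      by blast
  next
    fix y assume y: "y \<in> X"
    let ?C = "nsq (kernel_fun X K y) + 1"
    have C: "?C \<ge> 0"
      using nsq_nonneg[OF kernel_mem[OF y]] by simp
    have "(cmod (f y - F i y))\<^sup>2 \<le> ?C * inverse (real (Suc i))" for i
    proof -
      \<comment> \<open>Changing \<open>F i\<close> by a multiple of a kernel function does not
        leave the span, so the residual cannot be shortened below \<open>\<delta>\<close>.\<close>
      have "\<delta> \<le> nsq (\<lambda>x. f x - F i x + c * kernel_fun X K y x)" for c
        using lower[OF kernel_span.step[OF F y, of i "-c"]] by (simp add: D_def algebra_simps)
      then have "(cmod (f y - F i y))\<^sup>2 \<le> ?C * (D (F i) - \<delta>)"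
        using point_bound[OF diff_mem[OF f FH] y] by (simp add: D_def)
      also have "\<dots> \<le> ?C * inverse (real (Suc i))"
        using DF[of i] C by (intro mult_left_mono) auto
      finally show ?thesis .
    qed
    moreover have "(\<lambda>i. ?C * inverse (real (Suc i))) \<longlonglongrightarrow> ?C * 0"
      by (intro tendsto_mult_left LIMSEQ_inverse_real_of_nat)
    ultimately have "(\<lambda>i. (cmod (f y - F i y))\<^sup>2) \<longlonglongrightarrow> 0"
      by (rule_tac Lim_null_comparison[OF always_eventually, where g = "\<lambda>i. ?C * inverse (real (Suc i))"]) simp_all
    from tendsto_real_sqrt[OF this] have "(\<lambda>i. cmod (f y - F i y)) \<longlonglongrightarrow> 0"
      by simp
    then have "(\<lambda>i. f y - F i y) \<longlonglongrightarrow> 0"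
      by (rule tendsto_norm_zero_cancel)
    from tendsto_diff[OF tendsto_const[of "f y"] this] show "(\<lambda>i. F i y) \<longlonglongrightarrow> f y"
      by simp
  qed
qed

end

text \<open>The reproducing property fixes the inner product on the span, so a sequence there is
  Cauchy in both spaces at once. Its limit in \<open>H2\<close> has the same point values as its
  limit in \<open>H1\<close>, hence is the same function.\<close>

lemma is_rkhs_subset:
  assumes "is_rkhs X K H1 ip1" "is_rkhs X K H2 ip2"
  shows "H1 \<subseteq> H2"
proof
  interpret H1: reproducing_space X K H1 ip1 by standard fact
  interpret H2: reproducing_space X K H2 ip2 by standard fact
  have agree: "ip1 f g = ip2 f g" if "g \<in> kernel_span X K" "f \<in> kernel_span X K" for f g
    using that(1)
  proof induction
    case zero
    show ?case
      using H1.ip_scale_right[OF H1.kernel_span_subset[OF that(2)] H1.zero_mem, of 0]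
        H2.ip_scale_right[OF H2.kernel_span_subset[OF that(2)] H2.zero_mem, of 0] by simp
  next
    case (step g y c)
    then show ?case
      by (simp add: H1.ip_add_right H2.ip_add_right H1.ip_scale_right H2.ip_scale_right
          H1.reproducing H2.reproducing H1.kernel_mem H2.kernel_mem H1.scale_mem H2.scale_mem
          H1.kernel_span_subset H2.kernel_span_subset that(2))
  qed
  fix f assume f: "f \<in> H1"
  then obtain F where F: "\<And>i::nat. F i \<in> kernel_span X K"
    and cauchy: "\<And>e. e > 0 \<Longrightarrow> \<exists>N. \<forall>i\<ge>N. \<forall>k\<ge>N. ip_dist ip1 (F i) (F k) < e"
    and lim: "\<And>y. y \<in> X \<Longrightarrow> (\<lambda>i. F i y) \<longlonglongrightarrow> f y"
    by (metis H1.kernel_span_approx)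
  have "(\<lambda>x. F i x - F k x) \<in> kernel_span X K" for i k
    using kernel_span_add[OF kernel_span_scale[OF F[of k], of "-1"] F[of i]] by simp
  then have "ip_dist ip1 (F i) (F k) = ip_dist ip2 (F i) (F k)" for i k
    by (simp add: ip_dist_def agree)
  with cauchy obtain h where h: "h \<in> H2" "(\<lambda>i. ip_dist ip2 (F i) h) \<longlonglongrightarrow> 0"
    using H2.complete[of F] H2.kernel_span_subset[OF F] by metis
  have "f y = h y" for y
  proof (cases "y \<in> X")
    case True
    then show ?thesis
      using H2.tendsto_pointwise[OF H2.kernel_span_subset[OF F] h] lim LIMSEQ_unique by blast
  qed (simp add: H1.outside[OF f] H2.outside[OF h(1)])
  with h(1) show "f \<in> H2"
    by (metis ext)
qed

lemma rkhs_eqI: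
  assumes "is_rkhs X K H ip"
  shows "rkhs X K = H"
proof -
  have "\<exists>ip'. is_rkhs X K (rkhs X K) ip'"
    unfolding rkhs_def by (rule someI_ex) (use assms in blast)
  with assms show ?thesis
    by (metis is_rkhs_subset subset_antisym)
qed

subsection \<open>Spaces of square-summable expansions\<close>

text \<open>Vanishing outside \<open>I\<close> makes equality of total functions the right equality
  of coefficient families, without which \<open>synthesis\<close> could not be injective.\<close>

definition l2 :: "'i set \<Rightarrow> ('i \<Rightarrow> complex) set" where
  "l2 I = {c. (\<forall>i. i \<notin> I \<longrightarrow> c i = 0) \<and> (\<lambda>i. (cmod (c i))\<^sup>2) summable_on I}"

definition l2_nsq :: "'i set \<Rightarrow> ('i \<Rightarrow> complex) \<Rightarrow> real" where
  "l2_nsq I c = (\<Sum>\<^sub>\<infinity>i\<in>I. (cmod (c i))\<^sup>2)"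

lemma abs_summable_mult_of_squares:
  fixes a b :: "'i \<Rightarrow> complex"
  assumes "(\<lambda>i. (cmod (a i))\<^sup>2) summable_on I" "(\<lambda>i. (cmod (b i))\<^sup>2) summable_on I"
  shows "(\<lambda>i. cmod (a i * b i)) summable_on I"
  by (rule abs_summable_product) (use assms in \<open>simp_all add: norm_mult power2_eq_square\<close>)

lemma l2_summable: "c \<in> l2 I \<Longrightarrow> (\<lambda>i. (cmod (c i))\<^sup>2) summable_on I"
  by (simp add: l2_def)

lemma l2_mult_summable:
  "c \<in> l2 I \<Longrightarrow> (\<lambda>i. (cmod (b i))\<^sup>2) summable_on I \<Longrightarrow> (\<lambda>i. c i * b i) summable_on I"
  by (rule abs_summable_summable[OF abs_summable_mult_of_squares[OF l2_summable]])

lemma l2_zero: "(\<lambda>i. 0) \<in> l2 I"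
  by (simp add: l2_def)

lemma l2_scale: "c \<in> l2 I \<Longrightarrow> (\<lambda>i. a * c i) \<in> l2 I"
  by (auto simp: l2_def norm_mult power_mult_distrib intro!: summable_on_cmult_right)

lemma l2_add:
  assumes "c \<in> l2 I" "d \<in> l2 I"
  shows "(\<lambda>i. c i + d i) \<in> l2 I"
proof -
  have "(\<lambda>i. (cmod (c i + d i))\<^sup>2) summable_on I"
  proof (rule summable_on_comparison_test)
    show "(\<lambda>i. 2 * (cmod (c i))\<^sup>2 + 2 * (cmod (d i))\<^sup>2) summable_on I"
      using assms by (intro summable_on_add summable_on_cmult_right l2_summable)
  next
    fix i
    have "(cmod (c i + d i))\<^sup>2 \<le> (cmod (c i) + cmod (d i))\<^sup>2"
      by (intro power_mono norm_triangle_ineq) simp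
    also have "\<dots> \<le> 2 * (cmod (c i))\<^sup>2 + 2 * (cmod (d i))\<^sup>2"
      using sum_squares_bound[of "cmod (c i)" "cmod (d i)"] by (simp add: power2_sum)
    finally show "(cmod (c i + d i))\<^sup>2 \<le> 2 * (cmod (c i))\<^sup>2 + 2 * (cmod (d i))\<^sup>2" .
  qed simp
  with assms show ?thesis
    by (simp add: l2_def)
qed

lemma l2_diff: "c \<in> l2 I \<Longrightarrow> d \<in> l2 I \<Longrightarrow> (\<lambda>i. c i - d i) \<in> l2 I"
  using l2_add[of c I "\<lambda>i. -1 * d i"] l2_scale[of d I "-1"] by simp

lemma l2_partial_sum_le:
  assumes "c \<in> l2 I" "finite G" "G \<subseteq> I"
  shows "(\<Sum>i\<in>G. (cmod (c i))\<^sup>2) \<le> l2_nsq I c"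
  unfolding l2_nsq_def using assms by (intro finite_sum_le_infsum) (auto simp: l2_summable)

lemma l2_bounded:
  assumes "\<And>i. i \<notin> I \<Longrightarrow> c i = 0"
    and "\<And>G. finite G \<Longrightarrow> G \<subseteq> I \<Longrightarrow> (\<Sum>i\<in>G. (cmod (c i))\<^sup>2) \<le> B"
  shows "c \<in> l2 I" "l2_nsq I c \<le> B"
proof -
  have *: "(\<lambda>i. (cmod (c i))\<^sup>2) summable_on I"
    by (rule nonneg_bdd_above_summable_on) (auto intro!: bdd_aboveI2[of _ _ B] assms(2))
  with assms(1) show "c \<in> l2 I"
    by (simp add: l2_def)
  show "l2_nsq I c \<le> B"
    unfolding l2_nsq_def by (rule infsum_le_finite_sums[OF * assms(2)])
qed

text \<open>The limit is taken in each coordinate. Norm bounds survive because they are first passed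
  to the limit on finite index sets, where limit and sum commute, and then extended to
  \<open>I\<close> by \<open>l2_bounded\<close>.\<close>

lemma l2_complete:
  fixes F :: "nat \<Rightarrow> 'i \<Rightarrow> complex"
  assumes F: "\<And>k. F k \<in> l2 I"
    and cauchy: "\<And>e. e > 0 \<Longrightarrow> \<exists>N. \<forall>j\<ge>N. \<forall>k\<ge>N. sqrt (l2_nsq I (\<lambda>i. F j i - F k i)) < e"
  obtains c where "c \<in> l2 I" "(\<lambda>k. sqrt (l2_nsq I (\<lambda>i. F k i - c i))) \<longlonglongrightarrow> 0"
proof -
  have le: "(\<Sum>i\<in>G. (cmod (F j i - F k i))\<^sup>2) \<le> l2_nsq I (\<lambda>i. F j i - F k i)" if "finite G" "G \<subseteq> I" for j k G
    by (rule l2_partial_sum_le[OF l2_diff[OF F F] that])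
  have "\<exists>l. (\<lambda>k. F k i) \<longlonglongrightarrow> l" for i
  proof (cases "i \<in> I")
    case True
    have "Cauchy (\<lambda>k. F k i)"
    proof (rule metric_CauchyI)
      fix e :: real assume "e > 0"
      then obtain N where N: "\<forall>j\<ge>N. \<forall>k\<ge>N. sqrt (l2_nsq I (\<lambda>i. F j i - F k i)) < e"
        using cauchy by blast
      have "dist (F j i) (F k i) < e" if "j \<ge> N" "k \<ge> N" for j k
      proof -
        have "sqrt ((cmod (F j i - F k i))\<^sup>2) \<le> sqrt (l2_nsq I (\<lambda>i. F j i - F k i))"
          using le[of "{i}"] True by (intro real_sqrt_le_mono) simp
        then have "dist (F j i) (F k i) \<le> sqrt (l2_nsq I (\<lambda>i. F j i - F k i))"
          by (simp add: dist_norm)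
        with N that show ?thesis
          by force
      qed
      then show "\<exists>M. \<forall>m\<ge>M. \<forall>n\<ge>M. dist (F m i) (F n i) < e"
        by blast
    qed
    then show ?thesis
      by (simp add: Cauchy_convergent_iff convergent_def)
  next
    case False
    with F have "(\<lambda>k. F k i) = (\<lambda>k. 0)"
      by (auto simp: l2_def)
    then show ?thesis
      by auto
  qed
  then obtain c where c: "\<And>i. (\<lambda>k. F k i) \<longlonglongrightarrow> c i"
    by metis
  have bound: "\<exists>N. \<forall>j\<ge>N. (\<lambda>i. F j i - c i) \<in> l2 I \<and> l2_nsq I (\<lambda>i. F j i - c i) \<le> e\<^sup>2" if e: "e > 0" for e
  proof -
    obtain N where N: "\<forall>j\<ge>N. \<forall>k\<ge>N. sqrt (l2_nsq I (\<lambda>i. F j i - F k i)) < e"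
      using cauchy[OF e] by blast
    have "(\<lambda>i. F j i - c i) \<in> l2 I \<and> l2_nsq I (\<lambda>i. F j i - c i) \<le> e\<^sup>2" if j: "j \<ge> N" for j
    proof -
      have "(\<Sum>i\<in>G. (cmod (F j i - c i))\<^sup>2) \<le> e\<^sup>2" if G: "finite G" "G \<subseteq> I" for G
      proof (rule LIMSEQ_le_const2)
        show "(\<lambda>k. \<Sum>i\<in>G. (cmod (F j i - F k i))\<^sup>2) \<longlonglongrightarrow> (\<Sum>i\<in>G. (cmod (F j i - c i))\<^sup>2)"
          by (intro tendsto_intros c)
        have "(\<Sum>i\<in>G. (cmod (F j i - F k i))\<^sup>2) \<le> e\<^sup>2" if "k \<ge> N" for k
        proof -
          have "sqrt (\<Sum>i\<in>G. (cmod (F j i - F k i))\<^sup>2) \<le> e"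
            using real_sqrt_le_mono[OF le[OF G, of j k]] N[rule_format, OF j that] by linarith
          then show ?thesis
            using real_le_rsqrt sqrt_le_D by blast
        qed
        then show "\<exists>N. \<forall>k\<ge>N. (\<Sum>i\<in>G. (cmod (F j i - F k i))\<^sup>2) \<le> e\<^sup>2"
          by blast
      qed
      moreover have "F j i - c i = 0" if "i \<notin> I" for i
      proof -
        have "(\<lambda>k. F k i) = (\<lambda>k. 0)"
          using that F by (auto simp: l2_def)
        with c[of i] have "c i = 0"
          using LIMSEQ_unique tendsto_const by metis
        with that F[of j] show ?thesis
          by (simp add: l2_def)
      qed
      ultimately show ?thesis
        using l2_bounded[of I "\<lambda>i. F j i - c i"] by blast
    qed
    then show ?thesis
      by blast
  qed
  obtain N where "(\<lambda>i. F N i - c i) \<in> l2 I"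
    using bound[of 1] by (meson le_refl zero_less_one)
  from l2_diff[OF F[of N] this] have "c \<in> l2 I"
    by simp
  moreover have "(\<lambda>k. sqrt (l2_nsq I (\<lambda>i. F k i - c i))) \<longlonglongrightarrow> 0"
  proof (rule LIMSEQ_I)
    fix e :: real assume e: "e > 0"
    then obtain N where N: "\<forall>j\<ge>N. l2_nsq I (\<lambda>i. F j i - c i) \<le> (e/2)\<^sup>2"
      using bound[of "e/2"] by auto
    have "sqrt (l2_nsq I (\<lambda>i. F j i - c i)) < e" if "j \<ge> N" for j
      using real_sqrt_le_mono[OF N[rule_format, OF that]] e by simp
    moreover have "l2_nsq I (\<lambda>i. F j i - c i) \<ge> 0" for j
      unfolding l2_nsq_def by (intro infsum_nonneg) simp
    ultimately show "\<exists>no. \<forall>k\<ge>no. norm (sqrt (l2_nsq I (\<lambda>i. F k i - c i)) - 0) < e"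
      by auto
  qed
  ultimately show ?thesis
    using that by blast
qed

section \<open>Reproducing kernel spaces built from an orthonormal basis\<close>

text \<open>The last assumption is what makes the features an orthonormal basis: if two coefficient
  families gave the same function, the inner product of coefficients would not be well defined on
  functions.\<close>

locale feature_expansion =
  fixes X :: "'x set" and K :: "'x \<Rightarrow> 'x \<Rightarrow> complex" and I :: "'i set" and e :: "'i \<Rightarrow> 'x \<Rightarrow> complex"
  assumes features_summable: "x \<in> X \<Longrightarrow> (\<lambda>i. (cmod (e i x))\<^sup>2) summable_on I"
    and kernel_expansion: "x \<in> X \<Longrightarrow> y \<in> X \<Longrightarrow> K x y = (\<Sum>\<^sub>\<infinity>i\<in>I. e i x * cnj (e i y))"
    and expansion_unique: "c \<in> l2 I \<Longrightarrow> (\<And>x. x \<in> X \<Longrightarrow> (\<Sum>\<^sub>\<infinity>i\<in>I. c i * e i x) = 0) \<Longrightarrow> c = (\<lambda>i. 0)"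
begin

definition synthesis :: "('i \<Rightarrow> complex) \<Rightarrow> 'x \<Rightarrow> complex" where
  "synthesis c = (\<lambda>x. if x \<in> X then \<Sum>\<^sub>\<infinity>i\<in>I. c i * e i x else 0)"

definition space :: "('x \<Rightarrow> complex) set" where
  "space = synthesis ` l2 I"

definition coef :: "('x \<Rightarrow> complex) \<Rightarrow> 'i \<Rightarrow> complex" where
  "coef = the_inv_into (l2 I) synthesis"

definition inner :: "('x \<Rightarrow> complex) \<Rightarrow> ('x \<Rightarrow> complex) \<Rightarrow> complex" where
  "inner f g = (\<Sum>\<^sub>\<infinity>i\<in>I. coef f i * cnj (coef g i))"

lemma synthesis_summable: "c \<in> l2 I \<Longrightarrow> x \<in> X \<Longrightarrow> (\<lambda>i. c i * e i x) summable_on I"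
  by (rule l2_mult_summable[OF _ features_summable])

lemma synthesis_add:
  "c \<in> l2 I \<Longrightarrow> d \<in> l2 I \<Longrightarrow> synthesis (\<lambda>i. c i + d i) = (\<lambda>x. synthesis c x + synthesis d x)"
  by (simp add: synthesis_def fun_eq_iff distrib_right synthesis_summable infsum_add)

lemma synthesis_scale: "synthesis (\<lambda>i. a * c i) = (\<lambda>x. a * synthesis c x)"
  by (simp add: synthesis_def fun_eq_iff mult.assoc infsum_cmult_right')

lemma synthesis_diff:
  "c \<in> l2 I \<Longrightarrow> d \<in> l2 I \<Longrightarrow> synthesis (\<lambda>i. c i - d i) = (\<lambda>x. synthesis c x - synthesis d x)"
  using synthesis_add[of c "\<lambda>i. -1 * d i"] synthesis_scale[of "-1" d] l2_scale[of d I "-1"]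
  by simp

lemma synthesis_inj: "inj_on synthesis (l2 I)"
proof (rule inj_onI)
  fix c d assume c: "c \<in> l2 I" and d: "d \<in> l2 I" and eq: "synthesis c = synthesis d"
  then have "synthesis (\<lambda>i. c i - d i) = (\<lambda>x. 0)"
    by (simp add: synthesis_diff)
  then have "(\<Sum>\<^sub>\<infinity>i\<in>I. (c i - d i) * e i x) = 0" if "x \<in> X" for x
    using that unfolding synthesis_def fun_eq_iff by metis
  from expansion_unique[OF l2_diff[OF c d] this] show "c = d"
    by (auto simp: fun_eq_iff)
qed

lemma coef_synthesis: "c \<in> l2 I \<Longrightarrow> coef (synthesis c) = c"
  unfolding coef_def by (rule the_inv_into_f_f[OF synthesis_inj])

lemma inner_synthesis:
  "c \<in> l2 I \<Longrightarrow> d \<in> l2 I \<Longrightarrow> inner (synthesis c) (synthesis d) = (\<Sum>\<^sub>\<infinity>i\<in>I. c i * cnj (d i))"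
  by (simp add: inner_def coef_synthesis)

lemma inner_synthesis_self:
  assumes "c \<in> l2 I"
  shows "inner (synthesis c) (synthesis c) = of_real (l2_nsq I c)"
proof -
  have "inner (synthesis c) (synthesis c) = (\<Sum>\<^sub>\<infinity>i\<in>I. of_real ((cmod (c i))\<^sup>2))"
    using assms by (simp add: inner_synthesis complex_norm_square del: of_real_power)
  also have "\<dots> = of_real (l2_nsq I c)"
    unfolding l2_nsq_def by (rule infsumI has_sum_of_real has_sum_infsum l2_summable assms)+
  finally show ?thesis .
qed

lemma dist_synthesis:
  "c \<in> l2 I \<Longrightarrow> d \<in> l2 I \<Longrightarrow>
     ip_dist inner (synthesis c) (synthesis d) = sqrt (l2_nsq I (\<lambda>i. c i - d i))"
  by (simp add: ip_dist_def l2_diff inner_synthesis_self flip: synthesis_diff)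

lemma cnj_summable: "d \<in> l2 I \<Longrightarrow> (\<lambda>i. (cmod (cnj (d i)))\<^sup>2) summable_on I"
  by (simp add: l2_summable)

lemma is_inner_product_space: "is_inner_product space inner"
  unfolding is_inner_product_def space_def ball_simps
proof (intro conjI ballI allI impI)
  fix c d h assume cdh: "c \<in> l2 I" "d \<in> l2 I" "h \<in> l2 I"
  then show "inner (\<lambda>x. synthesis c x + synthesis d x) (synthesis h) =
      inner (synthesis c) (synthesis h) + inner (synthesis d) (synthesis h)"
    by (simp add: inner_synthesis l2_add distrib_right l2_mult_summable[OF _ cnj_summable] infsum_add
        flip: synthesis_add)
next
  fix a c d assume "c \<in> l2 I" "d \<in> l2 I"
  then show "inner (\<lambda>x. a * synthesis c x) (synthesis d) = a * inner (synthesis c) (synthesis d)"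
    by (simp add: inner_synthesis l2_scale mult.assoc infsum_cmult_right' flip: synthesis_scale)
next
  fix c d assume "c \<in> l2 I" "d \<in> l2 I"
  then show "inner (synthesis d) (synthesis c) = cnj (inner (synthesis c) (synthesis d))"
    by (simp add: inner_synthesis mult.commute flip: infsum_cnj)
next
  fix c assume c: "c \<in> l2 I"
  then show "inner (synthesis c) (synthesis c) \<in> \<real>"
    by (simp add: inner_synthesis_self)
  show "0 \<le> Re (inner (synthesis c) (synthesis c))"
    using c by (simp add: inner_synthesis_self l2_nsq_def infsum_nonneg)
  assume "inner (synthesis c) (synthesis c) = 0"
  with c have 0: "l2_nsq I c = 0"
    by (simp add: inner_synthesis_self)
  have "c i = 0" for i
  proof (cases "i \<in> I")
    case True
    with 0 show ?thesis
      using l2_partial_sum_le[OF c, of "{i}"] by simp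
  qed (use c in \<open>simp add: l2_def\<close>)
  then show "synthesis c = (\<lambda>x. 0)"
    by (simp add: synthesis_def fun_eq_iff)
qed

lemma kernel_coef_mem: "y \<in> X \<Longrightarrow> (\<lambda>i. if i \<in> I then cnj (e i y) else 0) \<in> l2 I"
  using features_summable[of y] by (simp add: l2_def cong: summable_on_cong)

lemma kernel_fun_eq:
  assumes "y \<in> X"
  shows "kernel_fun X K y = synthesis (\<lambda>i. if i \<in> I then cnj (e i y) else 0)"
  unfolding kernel_fun_def synthesis_def fun_eq_iff
  by (auto simp: kernel_expansion assms mult.commute intro!: infsum_cong)

text \<open>\<open>synthesis\<close> transports the Hilbert space structure of \<open>l2 I\<close>.
  The kernel function at \<open>y\<close> has the coefficients \<open>cnj (e i y)\<close>, so
  pairing with it evaluates the expansion at \<open>y\<close>.\<close>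

theorem is_rkhs_space: "is_rkhs X K space inner"
  unfolding is_rkhs_def
proof (intro conjI)
  show "space \<subseteq> functions_on X"
    by (auto simp: space_def functions_on_def synthesis_def)
  show "(\<lambda>x. 0) \<in> space"
    unfolding space_def using l2_zero by (rule rev_image_eqI) (simp add: synthesis_def fun_eq_iff)
  show "\<forall>f\<in>space. \<forall>g\<in>space. (\<lambda>x. f x + g x) \<in> space"
    by (auto simp: space_def l2_add simp flip: synthesis_add)
  show "\<forall>c. \<forall>f\<in>space. (\<lambda>x. c * f x) \<in> space"
    by (auto simp: space_def l2_scale simp flip: synthesis_scale)
  show "is_inner_product space inner"
    by (rule is_inner_product_space)
  show "\<forall>y\<in>X. kernel_fun X K y \<in> space"
    by (simp add: space_def kernel_fun_eq kernel_coef_mem)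
  show "\<forall>f\<in>space. \<forall>y\<in>X. inner f (kernel_fun X K y) = f y"
    by (auto simp: space_def kernel_fun_eq kernel_coef_mem inner_synthesis)
      (auto simp: synthesis_def intro!: infsum_cong)
  show "\<forall>F. (\<forall>i::nat. F i \<in> space) \<and>
          (\<forall>e>0. \<exists>N. \<forall>i\<ge>N. \<forall>k\<ge>N. ip_dist inner (F i) (F k) < e) \<longrightarrow>
          (\<exists>f\<in>space. (\<lambda>i. ip_dist inner (F i) f) \<longlonglongrightarrow> 0)"
  proof (intro allI impI, elim conjE)
    fix F :: "nat \<Rightarrow> 'x \<Rightarrow> complex"
    assume F: "\<forall>i. F i \<in> space"
      and cauchy: "\<forall>e>0. \<exists>N. \<forall>i\<ge>N. \<forall>k\<ge>N. ip_dist inner (F i) (F k) < e"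
    have "\<forall>k. \<exists>c. c \<in> l2 I \<and> F k = synthesis c"
      using F unfolding space_def image_iff by blast
    then obtain C where C: "\<And>k. C k \<in> l2 I" and FC: "\<And>k. F k = synthesis (C k)"
      by metis
    have "\<exists>N. \<forall>j\<ge>N. \<forall>k\<ge>N. sqrt (l2_nsq I (\<lambda>i. C j i - C k i)) < e" if "e > 0" for e
      using cauchy that by (simp add: FC dist_synthesis C)
    from l2_complete[OF C this] obtain c
      where c: "c \<in> l2 I" "(\<lambda>k. sqrt (l2_nsq I (\<lambda>i. C k i - c i))) \<longlonglongrightarrow> 0" .
    show "\<exists>f\<in>space. (\<lambda>i. ip_dist inner (F i) f) \<longlonglongrightarrow> 0"
    proof
      show "synthesis c \<in> space"
        using c(1) by (simp add: space_def)
      show "(\<lambda>i. ip_dist inner (F i) (synthesis c)) \<longlonglongrightarrow> 0"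
        using c by (simp add: FC dist_synthesis C)
    qed
  qed
qed

lemma rkhs_eq: "rkhs X K = space"
  by (rule rkhs_eqI[OF is_rkhs_space])

end

subsection \<open>Power series expansion of the Drury--Arveson kernel\<close>

definition words :: "'j set \<Rightarrow> nat \<Rightarrow> 'j list set" where
  "words J k = {l. set l \<subseteq> J \<and> length l = k}"

text \<open>A nonempty word is its first letter and the rest. Summability over the pairs is assumed
  separately because convergence of the iterated sums does not imply it for complex terms.\<close>

lemma has_sum_words_Suc:
  fixes x :: "'j \<Rightarrow> 'a :: {real_normed_field, banach}"
  assumes "(x has_sum s) J" "((\<lambda>l. \<Prod>j\<leftarrow>l. x j) has_sum t) (words J k)"
    and "(\<lambda>(j, l). x j * (\<Prod>j\<leftarrow>l. x j)) summable_on (J \<times> words J k)"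
  shows "((\<lambda>l. \<Prod>j\<leftarrow>l. x j) has_sum (s * t)) (words J (Suc k))"
proof -
  have "((\<lambda>(j, l). x j * (\<Prod>j\<leftarrow>l. x j)) has_sum (s * t)) (J \<times> words J k)"
    using assms(3)
    by (intro has_sum_SigmaI[where g = "\<lambda>j. x j * t"])
      (auto intro!: has_sum_cmult_left has_sum_cmult_right assms(1,2))
  also have "?this \<longleftrightarrow> ?thesis"
    by (rule has_sum_reindex_bij_witness[of _ "\<lambda>l. (hd l, tl l)" "\<lambda>(j, l). j # l"])
      (auto simp: words_def length_Suc_conv)
  finally show ?thesis .
qed

text \<open>Grading the words by length turns the total into the geometric series of
  \<open>s\<close>.\<close>

lemma has_sum_all_words:
  fixes x :: "'j \<Rightarrow> 'a :: {real_normed_field, banach}"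
  assumes words: "\<And>k. ((\<lambda>l. \<Prod>j\<leftarrow>l. x j) has_sum (s ^ k)) (words J k)"
    and summable: "(\<lambda>(k, l). \<Prod>j\<leftarrow>l. x j) summable_on (SIGMA k:UNIV. words J k)"
    and s: "norm s < 1"
  shows "((\<lambda>l. \<Prod>j\<leftarrow>l. x j) has_sum (1 / (1 - s))) (lists J)"
proof -
  have "((\<lambda>k. s ^ k) has_sum (1 / (1 - s))) UNIV"
    using s by (intro norm_summable_imp_has_sum geometric_sums) (simp_all add: norm_power summable_geometric)
  with words summable have "((\<lambda>(k, l). \<Prod>j\<leftarrow>l. x j) has_sum (1 / (1 - s))) (SIGMA k:UNIV. words J k)"
    by (intro has_sum_SigmaI[where g = "\<lambda>k. s ^ k"]) auto
  also have "?this \<longleftrightarrow> ?thesis"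
    by (rule has_sum_reindex_bij_witness[of _ "\<lambda>l. (length l, l)" snd])
      (auto simp: words_def)
  finally show ?thesis .
qed

text \<open>For nonnegative terms the iterated sums do give summability over pairs. Applied to
  norms, this supplies the majorant for \<open>has_sum_words\<close>.\<close>

lemma has_sum_words_nonneg:
  fixes x :: "'j \<Rightarrow> real"
  assumes x: "(x has_sum s) J" and nonneg: "\<And>j. j \<in> J \<Longrightarrow> 0 \<le> x j" and s: "s < 1"
  shows "((\<lambda>l. \<Prod>j\<leftarrow>l. x j) has_sum (1 / (1 - s))) (lists J)"
proof (rule has_sum_all_words)
  have prod_nonneg: "0 \<le> (\<Prod>j\<leftarrow>l. x j)" if "l \<in> words J k" for l k
    using that unfolding words_def by (auto intro!: prod_list_nonneg nonneg)
  have s0: "0 \<le> s"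
    using has_sum_nonneg[OF x nonneg] .
  then show "norm s < 1"
    using s by simp
  show words: "((\<lambda>l. \<Prod>j\<leftarrow>l. x j) has_sum (s ^ k)) (words J k)" for k
  proof (induction k)
    case 0
    have "words J 0 = {[]}"
      by (auto simp: words_def)
    then show ?case
      by (simp add: has_sum_finite_iff)
  next
    case (Suc k)
    have "(\<lambda>(j, l). x j * (\<Prod>j\<leftarrow>l. x j)) summable_on (J \<times> words J k)"
    proof (rule summable_on_SigmaI[where g = "\<lambda>j. x j * s ^ k"])
      show "(\<lambda>j. x j * s ^ k) summable_on J"
        using has_sum_imp_summable[OF x] by (rule summable_on_cmult_left)
    qed (auto intro!: has_sum_cmult_right Suc mult_nonneg_nonneg nonneg prod_nonneg)
    from has_sum_words_Suc[OF x Suc this] show ?case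
      by simp
  qed
  show "(\<lambda>(k, l). \<Prod>j\<leftarrow>l. x j) summable_on (SIGMA k:UNIV. words J k)"
  proof (rule summable_on_SigmaI[where g = "\<lambda>k. s ^ k"])
    show "(\<lambda>k. s ^ k) summable_on UNIV"
      using s s0 by (intro norm_summable_imp_summable_on) (simp add: norm_power summable_geometric)
  qed (auto intro: words prod_nonneg)
qed

lemma norm_prod_list:
  fixes x :: "'j \<Rightarrow> 'a :: real_normed_field"
  shows "norm (\<Prod>j\<leftarrow>l. x j) = (\<Prod>j\<leftarrow>l. norm (x j))"
  by (induction l) (auto simp: norm_mult)

lemma has_sum_words:
  fixes x :: "'j \<Rightarrow> 'a :: {real_normed_field, banach}"
  assumes x: "((\<lambda>j. norm (x j)) has_sum s) J" and s: "s < 1"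
  shows "((\<lambda>l. \<Prod>j\<leftarrow>l. x j) has_sum (1 / (1 - infsum x J))) (lists J)"
proof (rule has_sum_all_words)
  have x': "(x has_sum infsum x J) J"
    by (rule has_sum_infsum[OF abs_summable_summable[OF has_sum_imp_summable[OF x]]])
  have "((\<lambda>l. norm (\<Prod>j\<leftarrow>l. x j)) has_sum (1 / (1 - s))) (lists J)"
    unfolding norm_prod_list by (rule has_sum_words_nonneg[OF x _ s]) simp
  then have summable: "(\<lambda>l. \<Prod>j\<leftarrow>l. x j) summable_on (lists J)"
    by (rule abs_summable_summable[OF has_sum_imp_summable])
  show "norm (infsum x J) < 1"
    using norm_infsum_bound[OF has_sum_imp_summable[OF x]] infsumI[OF x] s by simp
  show "((\<lambda>l. \<Prod>j\<leftarrow>l. x j) has_sum (infsum x J ^ k)) (words J k)" for k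
  proof (induction k)
    case 0
    have "words J 0 = {[]}"
      by (auto simp: words_def)
    then show ?case
      by (simp add: has_sum_finite_iff)
  next
    case (Suc k)
    have "(\<lambda>l. \<Prod>j\<leftarrow>l. x j) summable_on words J (Suc k)"
      by (rule summable_on_subset_banach[OF summable]) (auto simp: words_def)
    also have "?this \<longleftrightarrow> (\<lambda>(j, l). x j * (\<Prod>j\<leftarrow>l. x j)) summable_on (J \<times> words J k)"
      by (rule summable_on_reindex_bij_witness[of _ "\<lambda>(j, l). j # l" "\<lambda>l. (hd l, tl l)"])
        (auto simp: words_def length_Suc_conv)
    finally show ?case
      using has_sum_words_Suc[OF x' Suc] by simp
  qed
  show "(\<lambda>(k, l). \<Prod>j\<leftarrow>l. x j) summable_on (SIGMA k:UNIV. words J k)"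
  proof -
    note summable
    also have "(\<lambda>l. \<Prod>j\<leftarrow>l. x j) summable_on (lists J) \<longleftrightarrow> ?thesis"
      by (rule summable_on_reindex_bij_witness[of _ snd "\<lambda>l. (length l, l)"])
        (auto simp: words_def)
    finally show ?thesis .
  qed
qed

text \<open>Grouping words by their multiset of letters replaces a multinomial theorem in infinitely
  many variables: the words over \<open>\<alpha>\<close> are its permutations, and each of them
  contributes the same product.\<close>

lemma has_sum_multisets:
  fixes x :: "'j \<Rightarrow> complex"
  assumes "((\<lambda>j. cmod (x j)) has_sum s) J" "s < 1"
  shows "((\<lambda>\<alpha>. of_nat (card (permutations_of_multiset \<alpha>)) * (\<Prod>j\<in>#\<alpha>. x j))
           has_sum (1 / (1 - infsum x J))) {\<alpha>. set_mset \<alpha> \<subseteq> J}"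
proof -
  let ?I = "{\<alpha>. set_mset \<alpha> \<subseteq> J}"
  have "((\<lambda>l. \<Prod>j\<leftarrow>l. x j) has_sum (1 / (1 - infsum x J))) (lists J)"
    by (rule has_sum_words[OF assms])
  also have "?this \<longleftrightarrow> ((\<lambda>(\<alpha>, l). \<Prod>j\<leftarrow>l. x j) has_sum (1 / (1 - infsum x J)))
      (Sigma ?I permutations_of_multiset)"
    by (rule has_sum_reindex_bij_witness[of _ snd "\<lambda>l. (mset l, l)"])
      (auto simp: permutations_of_multiset_def subset_iff)
  finally show ?thesis
  proof (rule has_sum_SigmaD)
    fix \<alpha> :: "'j multiset"
    have "(\<Prod>j\<leftarrow>l. x j) = (\<Prod>j\<in>#\<alpha>. x j)" if "l \<in> permutations_of_multiset \<alpha>" for l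
      using permutations_of_multisetD[OF that] by (metis mset_map prod_mset_prod_list)
    then show "((\<lambda>l. case (\<alpha>, l) of (\<alpha>, l) \<Rightarrow> \<Prod>j\<leftarrow>l. x j) has_sum
        of_nat (card (permutations_of_multiset \<alpha>)) * (\<Prod>j\<in>#\<alpha>. x j)) (permutations_of_multiset \<alpha>)"
      by (intro has_sum_finiteI) auto
  qed
qed

section \<open>Normalized monomials\<close>

text \<open>Multisets are finite, so also for \<open>d = \<infinity>\<close> these are exactly the
  exponents of finite support.\<close>

definition multi_indices :: "enat \<Rightarrow> nat multiset set" where
  "multi_indices d = {\<alpha>. set_mset \<alpha> \<subseteq> index_set d}"

text \<open>The factor is the square root of a multinomial coefficient, which makes these monomials an
  orthonormal basis of the Drury--Arveson space.\<close>
definition basis_monomial :: "nat multiset \<Rightarrow> (nat \<Rightarrow> complex) \<Rightarrow> complex" where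
  "basis_monomial \<alpha> z = of_real (sqrt (card (permutations_of_multiset \<alpha>))) * (\<Prod>j\<in>#\<alpha>. z j)"

lemma cnj_prod_mset: "cnj (\<Prod>j\<in>#\<alpha>. z j) = (\<Prod>j\<in>#\<alpha>. cnj (z j))"
  by (induction \<alpha>) auto

lemma basis_monomial_mult_cnj:
  "basis_monomial \<alpha> z * cnj (basis_monomial \<alpha> w) =
     of_nat (card (permutations_of_multiset \<alpha>)) * (\<Prod>j\<in>#\<alpha>. z j * cnj (w j))"
proof -
  have square: "complex_of_real (sqrt (real m)) * of_real (sqrt (real m)) = of_nat m" for m
    by (simp flip: of_real_mult)
  have "basis_monomial \<alpha> z * cnj (basis_monomial \<alpha> w) =
      (of_real (sqrt (card (permutations_of_multiset \<alpha>))) * of_real (sqrt (card (permutations_of_multiset \<alpha>)))) *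
      ((\<Prod>j\<in>#\<alpha>. z j) * (\<Prod>j\<in>#\<alpha>. cnj (w j)))"
    by (simp add: basis_monomial_def cnj_prod_mset)
  then show ?thesis
    unfolding square prod_mset.distrib .
qed

lemma has_sum_basis_monomials:
  assumes z: "z \<in> unit_ball d" and w: "w \<in> unit_ball d"
  shows "((\<lambda>\<alpha>. basis_monomial \<alpha> z * cnj (basis_monomial \<alpha> w)) has_sum drury_arveson_kernel d z w)
           (multi_indices d)"
proof -
  have sz: "(\<lambda>j. (cmod (z j))\<^sup>2) summable_on index_set d" "(\<Sum>\<^sub>\<infinity>j\<in>index_set d. (cmod (z j))\<^sup>2) < 1"
    using z by (auto simp: unit_ball_def complex_space_def)
  have sw: "(\<lambda>j. (cmod (w j))\<^sup>2) summable_on index_set d" "(\<Sum>\<^sub>\<infinity>j\<in>index_set d. (cmod (w j))\<^sup>2) < 1"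
    using w by (auto simp: unit_ball_def complex_space_def)
  have summable: "(\<lambda>j. cmod (z j * cnj (w j))) summable_on index_set d"
    by (rule abs_summable_mult_of_squares) (use sz sw in simp_all)
  \<comment> \<open>The inequality between geometric and arithmetic mean, used termwise, suffices in
    place of Cauchy-Schwarz: the mean of two sums below 1 is below 1.\<close>
  have "(\<Sum>\<^sub>\<infinity>j\<in>index_set d. cmod (z j * cnj (w j))) \<le>
      (\<Sum>\<^sub>\<infinity>j\<in>index_set d. 1/2 * ((cmod (z j))\<^sup>2 + (cmod (w j))\<^sup>2))"
  proof (rule infsum_mono[OF summable])
    show "(\<lambda>j. 1/2 * ((cmod (z j))\<^sup>2 + (cmod (w j))\<^sup>2)) summable_on index_set d"
      using sz sw by (intro summable_on_cmult_right summable_on_add)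
    show "cmod (z j * cnj (w j)) \<le> 1/2 * ((cmod (z j))\<^sup>2 + (cmod (w j))\<^sup>2)" for j
      using sum_squares_bound[of "cmod (z j)" "cmod (w j)"] by (simp add: norm_mult)
  qed
  also have "\<dots> = 1/2 * ((\<Sum>\<^sub>\<infinity>j\<in>index_set d. (cmod (z j))\<^sup>2) + (\<Sum>\<^sub>\<infinity>j\<in>index_set d. (cmod (w j))\<^sup>2))"
    using sz sw by (simp only: infsum_cmult_right' infsum_add)
  also have "\<dots> < 1"
    using sz sw by simp
  finally show ?thesis
    unfolding basis_monomial_mult_cnj multi_indices_def drury_arveson_kernel_def cinner_d_def
    by (rule has_sum_multisets[OF has_sum_infsum[OF summable]])
qed

lemma basis_monomials_square_summable:
  assumes "z \<in> unit_ball d"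
  shows "(\<lambda>\<alpha>. (cmod (basis_monomial \<alpha> z))\<^sup>2) summable_on multi_indices d"
proof -
  have "(\<lambda>\<alpha>. of_real ((cmod (basis_monomial \<alpha> z))\<^sup>2) :: complex) summable_on multi_indices d"
    unfolding complex_norm_square
    by (rule has_sum_imp_summable[OF has_sum_basis_monomials[OF assms assms]])
  from summable_on_Re[OF this] show ?thesis
    by simp
qed

subsection \<open>Uniqueness for Dirichlet series\<close>

text \<open>After multiplication by the \<open>k\<close>-th power of the
  smallest frequency with a nonzero coefficient, the rest of the series tends to \<open>0\<close>.\<close>
lemma dirichlet_coefficients_zero:
  fixes a :: "'i \<Rightarrow> complex" and N :: "'i \<Rightarrow> nat"
  assumes summable: "(\<lambda>i. cmod (a i)) summable_on I"
    and inj: "inj_on N I" and pos: "\<And>i. i \<in> I \<Longrightarrow> 0 < N i"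
    and zero: "\<And>k. (\<Sum>\<^sub>\<infinity>i\<in>I. a i / of_nat (N i) ^ k) = 0"
    and "i \<in> I"
  shows "a i = 0"
proof (rule ccontr)
  assume "a i \<noteq> 0"
  with \<open>i \<in> I\<close> obtain i0 where i0: "i0 \<in> I" "a i0 \<noteq> 0"
    and least: "\<And>i. i \<in> I \<Longrightarrow> a i \<noteq> 0 \<Longrightarrow> N i0 \<le> N i"
    using ex_has_least_nat[of "\<lambda>i. i \<in> I \<and> a i \<noteq> 0" i N] by auto
  define T where "T = (\<Sum>\<^sub>\<infinity>i\<in>I - {i0}. cmod (a i))"
  \<comment> \<open>Frequencies are integers, so every other one with a nonzero coefficient is at
    least \<open>N i0 + 1\<close>; hence the tail decays with ratio \<open>r < 1\<close> relative to
    the leading term.\<close>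
  define r where "r = real (N i0) / (real (N i0) + 1)"
  have summable': "(\<lambda>i. cmod (a i)) summable_on (I - {i0})"
    using summable by (rule summable_on_subset_banach) auto
  have bound: "cmod (a i0) \<le> T * r ^ k" for k
  proof -
    have le: "cmod (a i / of_nat (N i) ^ k) \<le> cmod (a i) * (1 / (real (N i0) + 1)) ^ k"
      if i: "i \<in> I - {i0}" for i
    proof (cases "a i = 0")
      case False
      have "N i0 \<noteq> N i"
        using inj i i0 by (auto simp: inj_on_def)
      with least[of i] i False have N: "real (N i0) + 1 \<le> real (N i)"
        by force
      have "1 / real (N i) ^ k \<le> 1 / (real (N i0) + 1) ^ k"
        using N by (intro divide_left_mono power_mono mult_pos_pos zero_less_power) auto
      from mult_left_mono[OF this, of "cmod (a i)"] show ?thesis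
        by (simp add: norm_divide norm_power power_one_over)
    qed simp
    have "(\<lambda>i. cmod (a i / of_nat (N i) ^ k)) summable_on (I - {i0})"
      by (rule Infinite_Sum.abs_summable_on_comparison_test'[OF summable_on_cmult_left[OF summable'] le])
    then have f: "(\<lambda>i. a i / of_nat (N i) ^ k) summable_on (I - {i0})"
      by (rule abs_summable_summable)
    let ?R = "\<Sum>\<^sub>\<infinity>i\<in>I - {i0}. a i / of_nat (N i) ^ k"
    have "a i0 / of_nat (N i0) ^ k + ?R = (\<Sum>\<^sub>\<infinity>i\<in>insert i0 (I - {i0}). a i / of_nat (N i) ^ k)"
      by (rule infsum_insert[OF f, symmetric]) simp
    also have "\<dots> = 0"
      using zero[of k] i0 by (simp add: insert_absorb)
    finally have "a i0 / of_nat (N i0) ^ k = - ?R"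
      by (simp add: eq_neg_iff_add_eq_0)
    then have "cmod (a i0 / of_nat (N i0) ^ k) = cmod ?R"
      by simp
    also have "\<dots> \<le> T * (1 / (real (N i0) + 1)) ^ k"
      unfolding T_def
      by (rule norm_infsum_le[OF has_sum_infsum[OF f] has_sum_cmult_left[OF has_sum_infsum[OF summable']] le])
    finally show ?thesis
      using pos[OF i0(1)] by (simp add: norm_divide norm_power r_def field_simps)
  qed
  have "(\<lambda>k. T * r ^ k) \<longlonglongrightarrow> T * 0"
    by (intro tendsto_mult_left LIMSEQ_realpow_zero) (auto simp: r_def)
  then have "cmod (a i0) \<le> T * 0"
    by (rule LIMSEQ_le_const) (use bound in blast)
  with i0 show False
    by simp
qed

definition mult_value :: "(nat \<Rightarrow> nat) \<Rightarrow> nat multiset \<Rightarrow> nat" where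
  "mult_value n \<alpha> = (\<Prod>j\<in>#\<alpha>. n j)"

lemma mult_value_pos: "(\<And>j. j \<in># \<alpha> \<Longrightarrow> 0 < n j) \<Longrightarrow> 0 < mult_value n \<alpha>"
  unfolding mult_value_def by (induction \<alpha>) auto

lemma basis_monomial_divide:
  "basis_monomial \<alpha> (\<lambda>j. p j / of_nat (n j) ^ k) = basis_monomial \<alpha> p / of_nat (mult_value n \<alpha>) ^ k"
proof -
  have "(\<Prod>j\<in>#\<alpha>. p j / of_nat (n j) ^ k) = (\<Prod>j\<in>#\<alpha>. p j) / of_nat (mult_value n \<alpha>) ^ k"
    unfolding mult_value_def by (induction \<alpha>) (auto simp: power_mult_distrib)
  then show ?thesis
    by (simp add: basis_monomial_def)
qed

lemma card_permutations_of_multiset_pos: "0 < card (permutations_of_multiset \<alpha>)"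
  by (simp add: card_gt_0_iff)

lemma basis_monomial_nonzero:
  assumes "\<And>j. j \<in># \<alpha> \<Longrightarrow> p j \<noteq> 0"
  shows "basis_monomial \<alpha> p \<noteq> 0"
  using assms card_permutations_of_multiset_pos[of \<alpha>] by (auto simp: basis_monomial_def)

text \<open>Along the points \<open>p j / n j ^ k\<close> an expansion in monomials is a Dirichlet series in \<open>k\<close> with
  frequencies \<open>mult_value n \<alpha>\<close>.\<close>
lemma monomial_expansion_zero:
  assumes c: "c \<in> l2 (multi_indices d)" and p: "p \<in> unit_ball d"
    and nonzero: "\<And>j. j \<in> index_set d \<Longrightarrow> p j \<noteq> 0"
    and n: "\<And>j. j \<in> index_set d \<Longrightarrow> 0 < n j"
    and inj: "inj_on (mult_value n) (multi_indices d)"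
    and zero: "\<And>k. (\<Sum>\<^sub>\<infinity>\<alpha>\<in>multi_indices d. c \<alpha> * basis_monomial \<alpha> (\<lambda>j. p j / of_nat (n j) ^ k)) = 0"
  shows "c = (\<lambda>\<alpha>. 0)"
proof
  fix \<alpha>
  show "c \<alpha> = 0"
  proof (cases "\<alpha> \<in> multi_indices d")
    case True
    have "c \<alpha> * basis_monomial \<alpha> p = 0"
    proof (rule dirichlet_coefficients_zero[OF _ inj _ _ True])
      show "(\<lambda>\<alpha>. cmod (c \<alpha> * basis_monomial \<alpha> p)) summable_on multi_indices d"
        by (rule abs_summable_mult_of_squares[OF l2_summable[OF c] basis_monomials_square_summable[OF p]])
      show "0 < mult_value n \<alpha>" if "\<alpha> \<in> multi_indices d" for \<alpha>
        using that by (intro mult_value_pos n) (auto simp: multi_indices_def)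
      show "(\<Sum>\<^sub>\<infinity>\<alpha>\<in>multi_indices d. c \<alpha> * basis_monomial \<alpha> p / of_nat (mult_value n \<alpha>) ^ k) = 0" for k
        using zero[of k] by (simp add: basis_monomial_divide)
    qed
    moreover have "basis_monomial \<alpha> p \<noteq> 0"
      using True by (intro basis_monomial_nonzero nonzero) (auto simp: multi_indices_def)
    ultimately show ?thesis
      by simp
  qed (use c in \<open>simp add: l2_def\<close>)
qed

subsection \<open>The Drury--Arveson space as a space of expansions\<close>

lemma unit_ball_shrink:
  assumes "z \<in> unit_ball d" and le: "\<And>j. cmod (w j) \<le> cmod (z j)"
  shows "w \<in> unit_ball d"
proof -
  have z: "(\<lambda>j. (cmod (z j))\<^sup>2) summable_on index_set d" "(\<Sum>\<^sub>\<infinity>j\<in>index_set d. (cmod (z j))\<^sup>2) < 1"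
    and outside: "\<And>j. j \<notin> index_set d \<Longrightarrow> z j = 0"
    using assms(1) by (auto simp: unit_ball_def complex_space_def)
  have sq: "(cmod (w j))\<^sup>2 \<le> (cmod (z j))\<^sup>2" for j
    by (intro power_mono le) simp
  have w: "(\<lambda>j. (cmod (w j))\<^sup>2) summable_on index_set d"
    by (rule summable_on_comparison_test[OF z(1) sq]) simp
  have "w j = 0" if "j \<notin> index_set d" for j
    using le[of j] outside[OF that] by simp
  moreover have "(\<Sum>\<^sub>\<infinity>j\<in>index_set d. (cmod (w j))\<^sup>2) < 1"
    using infsum_mono[OF w z(1) sq] z(2) by simp
  ultimately show ?thesis
    using w by (simp add: unit_ball_def complex_space_def)
qed

lemma unit_ball_divide:
  assumes p: "p \<in> unit_ball d" and n: "\<And>j. j \<in> index_set d \<Longrightarrow> 0 < n j"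
  shows "(\<lambda>j. p j / of_nat (n j) ^ k) \<in> unit_ball d"
proof (rule unit_ball_shrink[OF p])
  fix j
  show "cmod (p j / of_nat (n j) ^ k) \<le> cmod (p j)"
  proof (cases "j \<in> index_set d")
    case True
    then have "1 \<le> real (n j) ^ k"
      using n[of j] by (simp add: one_le_power Suc_leI)
    then have "cmod (p j) / real (n j) ^ k \<le> cmod (p j) / 1"
      by (intro divide_left_mono) (use n[OF True] in auto)
    then show ?thesis
      by (simp add: norm_divide norm_power)
  qed (use p in \<open>simp add: unit_ball_def complex_space_def\<close>)
qed

text \<open>A base point with all coordinates nonzero, available for every \<open>d\<close>: the
  squared moduli are powers of 1/4, whose sum is at most 1/3.\<close>

lemma geometric_point_mem:
  "(\<lambda>j. if j \<in> index_set d then 1 / 2 ^ j else 0) \<in> unit_ball d"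
proof -
  let ?p = "\<lambda>j. if j \<in> index_set d then 1 / 2 ^ j else (0 :: complex)"
  have "((\<lambda>j. (1/4 :: real) ^ j) has_sum (1/4) / (1 - 1/4)) {1..}"
    by (rule has_sum_geometric_from_1) simp
  then have geometric: "((\<lambda>j. (1/4 :: real) ^ j) has_sum 1/3) {1..}"
    by simp
  have sq: "(cmod (?p j))\<^sup>2 = (1/4) ^ j" if "j \<in> index_set d" for j
    using that power_mult_distrib[of "2 :: real" 2 j]
    by (simp add: norm_divide norm_power power2_eq_square field_simps)
  have sub: "index_set d \<subseteq> {1..}"
    by (auto simp: index_set_def)
  have summable: "(\<lambda>j. (1/4 :: real) ^ j) summable_on index_set d"
    by (rule summable_on_subset_banach[OF has_sum_imp_summable[OF geometric] sub])
  have "(\<Sum>\<^sub>\<infinity>j\<in>index_set d. (1/4 :: real) ^ j) \<le> 1/3"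
    using infsum_mono2[OF summable has_sum_imp_summable[OF geometric] sub] infsumI[OF geometric] by simp
  with summable sq show ?thesis
    by (simp add: unit_ball_def complex_space_def cong: summable_on_cong infsum_cong)
qed

text \<open>Unique factorization: the prime factorization of the product recovers the
  multiset.\<close>

lemma mult_value_primes_inj: "inj (mult_value (enumerate {p. prime p}))"
proof (rule injI)
  let ?q = "enumerate {p :: nat. prime p}"
  have prime: "prime (?q j)" for j
    using enumerate_in_set[OF primes_infinite, of j] by simp
  have factors: "prime_factorization (mult_value ?q \<alpha>) = image_mset ?q \<alpha>" for \<alpha>
    unfolding mult_value_def by (rule prime_factorization_prod_mset_primes) (auto simp: prime)
  have "inj ?q"
    using strict_mono_enumerate[OF primes_infinite] by (rule strict_mono_imp_inj_on)
  fix \<alpha> \<beta> assume "mult_value ?q \<alpha> = mult_value ?q \<beta>"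
  then have "image_mset ?q \<alpha> = image_mset ?q \<beta>"
    by (metis factors)
  with multiset.inj_map[OF \<open>inj ?q\<close>] show "\<alpha> = \<beta>"
    by (rule injD)
qed

text \<open>Uniqueness of the expansion uses the Dirichlet series of the primes, whose logarithms are
  linearly independent.\<close>
lemma feature_expansion_drury_arveson:
  "feature_expansion (unit_ball d) (drury_arveson_kernel d) (multi_indices d) basis_monomial"
proof
  fix z w assume "z \<in> unit_ball d" "w \<in> unit_ball d"
  then show "drury_arveson_kernel d z w =
      (\<Sum>\<^sub>\<infinity>\<alpha>\<in>multi_indices d. basis_monomial \<alpha> z * cnj (basis_monomial \<alpha> w))"
    by (rule infsumI[OF has_sum_basis_monomials, symmetric])
next
  fix z assume "z \<in> unit_ball d"
  then show "(\<lambda>\<alpha>. (cmod (basis_monomial \<alpha> z))\<^sup>2) summable_on multi_indices d"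
    by (rule basis_monomials_square_summable)
next
  fix c assume c: "c \<in> l2 (multi_indices d)"
    and zero: "\<And>z. z \<in> unit_ball d \<Longrightarrow> (\<Sum>\<^sub>\<infinity>\<alpha>\<in>multi_indices d. c \<alpha> * basis_monomial \<alpha> z) = 0"
  let ?p = "\<lambda>j. if j \<in> index_set d then 1 / 2 ^ j else (0 :: complex)"
  let ?q = "enumerate {p :: nat. prime p}"
  have pos: "0 < ?q j" for j
    using enumerate_in_set[OF primes_infinite, of j] by (simp add: prime_gt_0_nat)
  show "c = (\<lambda>\<alpha>. 0)"
  proof (rule monomial_expansion_zero[OF c geometric_point_mem])
    show "inj_on (mult_value ?q) (multi_indices d)"
      using mult_value_primes_inj by (rule inj_on_subset) simp
    show "(\<Sum>\<^sub>\<infinity>\<alpha>\<in>multi_indices d. c \<alpha> * basis_monomial \<alpha> (\<lambda>j. ?p j / of_nat (?q j) ^ k)) = 0" for k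
      by (rule zero[OF unit_ball_divide[OF geometric_point_mem pos]])
  qed (simp_all add: pos)
qed

subsection \<open>Multipliers\<close>

lemma drury_arveson_space_eq:
  "drury_arveson_space d =
     feature_expansion.space (unit_ball d) (multi_indices d) basis_monomial"
  unfolding drury_arveson_space_def
  by (rule feature_expansion.rkhs_eq[OF feature_expansion_drury_arveson])

lemma reproducing_drury_arveson:
  "\<exists>ip. reproducing_space (unit_ball d) (drury_arveson_kernel d) (drury_arveson_space d) ip"
  unfolding drury_arveson_space_eq
  using feature_expansion.is_rkhs_space[OF feature_expansion_drury_arveson]
  by (auto simp: reproducing_space_def)

text \<open>Prefixing \<open>j\<close> is injective. This bounds the ratio of normalizing factors by
  1 in \<open>coordinate_multiplier\<close>.\<close>

lemma card_permutations_of_multiset_mono: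
  "card (permutations_of_multiset \<alpha>) \<le> card (permutations_of_multiset (add_mset j \<alpha>))"
  by (rule card_inj_on_le[OF _ _ finite_permutations_of_multiset, of "\<lambda>l. j # l"])
    (auto simp: permutations_of_multiset_def)

text \<open>Multiplication by a coordinate is a weighted shift of coefficients from
  \<open>\<alpha>\<close> to \<open>add_mset j \<alpha>\<close>, with weights at most 1; so it
  preserves square-summability.\<close>

lemma coordinate_multiplier:
  assumes f: "f \<in> drury_arveson_space d" and j: "j \<in> index_set d"
  shows "(\<lambda>z. z j * f z) \<in> drury_arveson_space d"
proof -
  let ?I = "multi_indices d"
  interpret E: feature_expansion "unit_ball d" "drury_arveson_kernel d" ?I basis_monomial
    by (rule feature_expansion_drury_arveson)
  obtain c where c: "c \<in> l2 ?I" and fc: "f = E.synthesis c"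
    using f unfolding drury_arveson_space_eq E.space_def by blast
  define q where "q \<alpha> = sqrt (card (permutations_of_multiset \<alpha>))" for \<alpha> :: "nat multiset"
  have q: "0 < q \<alpha>" "q \<alpha> \<le> q (add_mset j \<alpha>)" for \<alpha>
    using card_permutations_of_multiset_pos[of \<alpha>] card_permutations_of_multiset_mono[of \<alpha> j]
    by (simp_all add: q_def)
  \<comment> \<open>The quotient of the two \<open>q\<close> factors converts the normalization of
    the smaller monomial into that of the larger one.\<close>
  define c' where "c' \<beta> = (if j \<in># \<beta> then c (\<beta> - {#j#}) * of_real (q (\<beta> - {#j#}) / q \<beta>) else 0)" for \<beta>
  have c'_add: "c' (add_mset j \<alpha>) = c \<alpha> * of_real (q \<alpha> / q (add_mset j \<alpha>))" for \<alpha>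
    by (simp add: c'_def)
  have inj: "inj_on (add_mset j) ?I"
    by (auto simp: inj_on_def)
  have sub: "add_mset j ` ?I \<subseteq> ?I"
    using j by (auto simp: multi_indices_def)
  have c'0: "c' \<beta> = 0" if "\<beta> \<in> ?I - add_mset j ` ?I" for \<beta>
  proof -
    have "\<beta> - {#j#} \<in> ?I"
      using that by (auto simp: multi_indices_def dest: in_diffD)
    with that have "j \<notin># \<beta>"
      by (metis Diff_iff image_eqI insert_DiffM)
    then show ?thesis
      by (simp add: c'_def)
  qed
  have "(\<lambda>\<alpha>. (cmod (c' (add_mset j \<alpha>)))\<^sup>2) summable_on ?I"
  proof (rule summable_on_comparison_test[OF l2_summable[OF c]])
    fix \<alpha>
    have "cmod (c' (add_mset j \<alpha>)) = cmod (c \<alpha>) * (q \<alpha> / q (add_mset j \<alpha>))"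
      using q(1)[of \<alpha>] q(1)[of "add_mset j \<alpha>"] by (simp add: c'_add norm_mult norm_divide)
    also have "\<dots> \<le> cmod (c \<alpha>) * 1"
      using q(1)[of "add_mset j \<alpha>"] q(2)[of \<alpha>] by (intro mult_left_mono) auto
    finally show "(cmod (c' (add_mset j \<alpha>)))\<^sup>2 \<le> (cmod (c \<alpha>))\<^sup>2"
      by (intro power_mono) auto
  qed simp
  then have "(\<lambda>\<beta>. (cmod (c' \<beta>))\<^sup>2) summable_on add_mset j ` ?I"
    by (simp add: summable_on_reindex[OF inj] o_def)
  also have "?this \<longleftrightarrow> (\<lambda>\<beta>. (cmod (c' \<beta>))\<^sup>2) summable_on ?I"
    using c'0 sub by (intro summable_on_cong_neutral) auto
  finally have summable: "(\<lambda>\<beta>. (cmod (c' \<beta>))\<^sup>2) summable_on ?I" .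
  have "c' \<beta> = 0" if "\<beta> \<notin> ?I" for \<beta>
  proof (cases "j \<in># \<beta>")
    case True
    with that j have "\<beta> - {#j#} \<notin> ?I"
      unfolding multi_indices_def by (metis insert_DiffM insert_subset mem_Collect_eq set_mset_add_mset_insert)
    with c show ?thesis
      by (simp add: c'_def l2_def)
  qed (simp add: c'_def)
  with summable have c': "c' \<in> l2 ?I"
    by (simp add: l2_def)
  have "E.synthesis c' z = z j * f z" for z
  proof (cases "z \<in> unit_ball d")
    case True
    have shift: "c' (add_mset j \<alpha>) * basis_monomial (add_mset j \<alpha>) z = z j * (c \<alpha> * basis_monomial \<alpha> z)" for \<alpha>
      using q(1)[of \<alpha>] q(1)[of "add_mset j \<alpha>"]
      unfolding c'_add basis_monomial_def q_def[symmetric] by simp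
    have "(\<Sum>\<^sub>\<infinity>\<beta>\<in>?I. c' \<beta> * basis_monomial \<beta> z) = (\<Sum>\<^sub>\<infinity>\<beta>\<in>add_mset j ` ?I. c' \<beta> * basis_monomial \<beta> z)"
      using c'0 sub by (intro infsum_cong_neutral) auto
    also have "\<dots> = (\<Sum>\<^sub>\<infinity>\<alpha>\<in>?I. c' (add_mset j \<alpha>) * basis_monomial (add_mset j \<alpha>) z)"
      by (simp add: infsum_reindex[OF inj] o_def)
    also have "\<dots> = z j * (\<Sum>\<^sub>\<infinity>\<alpha>\<in>?I. c \<alpha> * basis_monomial \<alpha> z)"
      unfolding shift by (rule infsum_cmult_right')
    finally show ?thesis
      using True by (simp add: fc E.synthesis_def)
  qed (simp add: fc E.synthesis_def)
  then have "(\<lambda>z. z j * f z) = E.synthesis c'"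
    by auto
  with c' show ?thesis
    unfolding drury_arveson_space_eq E.space_def by blast
qed

lemma monomial_multiplier:
  assumes "f \<in> drury_arveson_space d" "\<alpha> \<in> multi_indices d"
  shows "(\<lambda>z. (\<Prod>j\<in>#\<alpha>. z j) * f z) \<in> drury_arveson_space d"
  using assms(2)
proof (induction \<alpha>)
  case (add j \<alpha>)
  then have "(\<lambda>z. z j * ((\<Prod>j\<in>#\<alpha>. z j) * f z)) \<in> drury_arveson_space d"
    by (intro coordinate_multiplier) (auto simp: multi_indices_def)
  then show ?case
    by (simp add: mult.assoc)
qed (use assms(1) in simp)

text \<open>The cutoff is forced by the convention that multipliers vanish outside the ball. It does
  not change the product with \<open>f\<close>, which vanishes there too.\<close>

lemma binomial_multiplier:
  assumes "\<alpha> \<in> multi_indices d" "\<beta> \<in> multi_indices d"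
  shows "(\<lambda>z. if z \<in> unit_ball d then a * (\<Prod>j\<in>#\<alpha>. z j) + b * (\<Prod>j\<in>#\<beta>. z j) else 0)
           \<in> drury_arveson_multipliers d"
proof -
  obtain ip where "reproducing_space (unit_ball d) (drury_arveson_kernel d) (drury_arveson_space d) ip"
    using reproducing_drury_arveson by blast
  then interpret reproducing_space "unit_ball d" "drury_arveson_kernel d" "drury_arveson_space d" ip .
  have "(\<lambda>z. (if z \<in> unit_ball d then a * (\<Prod>j\<in>#\<alpha>. z j) + b * (\<Prod>j\<in>#\<beta>. z j) else 0) * f z)
      \<in> drury_arveson_space d" if f: "f \<in> drury_arveson_space d" for f
  proof -
    have "(\<lambda>z. a * ((\<Prod>j\<in>#\<alpha>. z j) * f z) + b * ((\<Prod>j\<in>#\<beta>. z j) * f z)) \<in> drury_arveson_space d"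
      by (intro add_mem scale_mem monomial_multiplier f assms)
    also have "(\<lambda>z. a * ((\<Prod>j\<in>#\<alpha>. z j) * f z) + b * ((\<Prod>j\<in>#\<beta>. z j) * f z)) =
        (\<lambda>z. (if z \<in> unit_ball d then a * (\<Prod>j\<in>#\<alpha>. z j) + b * (\<Prod>j\<in>#\<beta>. z j) else 0) * f z)"
      by (auto simp: fun_eq_iff algebra_simps outside[OF f])
    finally show ?thesis .
  qed
  then show ?thesis
    by (simp add: drury_arveson_multipliers_def multiplier_algebra_def functions_on_def)
qed

text \<open>The constant 1 on the ball is the kernel function at the origin, and a multiplier is its
  own product with it.\<close>

lemma multiplier_mem_space:
  assumes g: "g \<in> drury_arveson_multipliers d"
  shows "g \<in> drury_arveson_space d"
proof -
  obtain ip where "reproducing_space (unit_ball d) (drury_arveson_kernel d) (drury_arveson_space d) ip"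
    using reproducing_drury_arveson by blast
  then interpret reproducing_space "unit_ball d" "drury_arveson_kernel d" "drury_arveson_space d" ip .
  let ?one = "kernel_fun (unit_ball d) (drury_arveson_kernel d) (\<lambda>j. 0)"
  have one: "?one z = (if z \<in> unit_ball d then 1 else 0)" for z
    by (simp add: kernel_fun_def drury_arveson_kernel_def cinner_d_def)
  have "(\<lambda>j. 0) \<in> unit_ball d"
    by (simp add: unit_ball_def complex_space_def)
  then have "(\<lambda>z. g z * ?one z) \<in> drury_arveson_space d"
    using g kernel_mem by (auto simp: drury_arveson_multipliers_def multiplier_algebra_def)
  also have "(\<lambda>z. g z * ?one z) = g"
    using g by (auto simp: one drury_arveson_multipliers_def multiplier_algebra_def functions_on_def)
  finally show ?thesis .
qed

subsection \<open>Linear independence of the logarithms\<close>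

text \<open>Summing over a common finite set \<open>T\<close> rather than over the support lets two
  multisets be compared term by term.\<close>

lemma ln_mult_value:
  assumes "finite T" "set_mset \<alpha> \<subseteq> T" "\<And>j. j \<in> T \<Longrightarrow> 0 < n j"
  shows "ln (real (mult_value n \<alpha>)) = (\<Sum>j\<in>T. real (count \<alpha> j) * ln (real (n j)))"
  using assms(2)
proof (induction \<alpha>)
  case (add i \<alpha>)
  then have "0 < n i" "0 < mult_value n \<alpha>"
    using assms(3) by (auto intro!: mult_value_pos)
  then have "ln (real (n i * mult_value n \<alpha>)) = ln (real (n i)) + ln (real (mult_value n \<alpha>))"
    by (simp add: ln_mult)
  moreover have "mult_value n (add_mset i \<alpha>) = n i * mult_value n \<alpha>"
    by (simp add: mult_value_def)
  ultimately have "ln (real (mult_value n (add_mset i \<alpha>))) = ln (real (n i)) + ln (real (mult_value n \<alpha>))"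
    by simp
  also have "\<dots> = (\<Sum>j\<in>T. if j = i then ln (real (n j)) else 0) + (\<Sum>j\<in>T. real (count \<alpha> j) * ln (real (n j)))"
    using add assms(1) by simp
  also have "\<dots> = (\<Sum>j\<in>T. real (count (add_mset i \<alpha>) j) * ln (real (n j)))"
    unfolding sum.distrib[symmetric] by (intro sum.cong) (auto simp: algebra_simps)
  finally show ?case .
qed (simp add: mult_value_def)

lemma common_denominator:
  fixes q :: "'i \<Rightarrow> rat"
  assumes "finite T"
  obtains D :: int and m :: "'i \<Rightarrow> int" where "D > 0" "\<And>j. j \<in> T \<Longrightarrow> of_int (m j) = of_int D * q j"
proof -
  have "\<exists>(D::int) (m::'i \<Rightarrow> int). D > 0 \<and> (\<forall>j\<in>T. of_int (m j) = of_int D * q j)"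
    using assms
  proof induction
    case empty
    show ?case
      by (intro exI[of _ 1]) simp
  next
    case (insert i T)
    then obtain D :: int and m :: "'i \<Rightarrow> int" where D: "D > 0" "\<forall>j\<in>T. of_int (m j) = of_int D * q j"
      by blast
    obtain a b :: int where ab: "q i = of_int a / of_int b" "b > 0"
      by (metis quotient_of_denom_pos quotient_of_div surj_pair)
    have "\<forall>j\<in>insert i T. of_int (if j = i then D * a else b * m j) = of_int (D * b) * q j"
      using D ab insert.hyps by auto
    moreover have "0 < D * b"
      using D ab by simp
    ultimately show ?case
      by (intro exI[of _ "D * b"] exI[of _ "\<lambda>j. if j = i then D * a else b * m j"] conjI)
  qed
  with that show ?thesis
    by blast
qed

lemma count_sum_replicate:
  assumes "finite T"
  shows "count (\<Sum>j\<in>T. replicate_mset (m j) j) i = (if i \<in> T then m i else 0)"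
  using assms by (simp add: count_sum)

lemma module_rat_real: "module (\<lambda>(q::rat) (x::real). of_rat q * x)"
  by unfold_locales (simp_all add: algebra_simps of_rat_add of_rat_mult)

text \<open>A coincidence of two products is an integer relation between logarithms, with the
  differences of multiplicities as coefficients. Conversely, clearing denominators makes a rational
  relation integral, and its positive and negative parts are the two multisets. Independence of a
  set does not see repetitions, hence the injectivity of \<open>n\<close>.\<close>

lemma independent_ln_iff:
  assumes n: "\<And>j. j \<in> J \<Longrightarrow> 0 < n j" and inj_n: "inj_on n J"
  shows "module.independent (\<lambda>(q::rat) (x::real). of_rat q * x) ((\<lambda>j. ln (real (n j))) ` J) \<longleftrightarrow>
         inj_on (mult_value n) {\<alpha>. set_mset \<alpha> \<subseteq> J}" (is "?indep \<longleftrightarrow> ?inj")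
proof -
  interpret module "\<lambda>(q::rat) (x::real). of_rat q * x"
    by (rule module_rat_real)
  let ?L = "\<lambda>j. ln (real (n j))"
  have inj_L: "inj_on ?L J"
    using n inj_n by (auto simp: inj_on_def)
  show ?thesis
  proof
    assume indep: ?indep
    show ?inj
    proof (rule inj_onI)
      fix \<alpha> \<beta> assume \<alpha>: "\<alpha> \<in> {\<alpha>. set_mset \<alpha> \<subseteq> J}" and \<beta>: "\<beta> \<in> {\<alpha>. set_mset \<alpha> \<subseteq> J}"
        and eq: "mult_value n \<alpha> = mult_value n \<beta>"
      let ?T = "set_mset \<alpha> \<union> set_mset \<beta>"
      have T: "finite ?T" "?T \<subseteq> J"
        using \<alpha> \<beta> by auto
      have inj_T: "inj_on ?L ?T"
        using inj_L T(2) by (rule inj_on_subset)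
      have pos: "0 < n j" if "j \<in> ?T" for j
        using n T(2) that by blast
      \<comment> \<open>Coefficients of a relation are indexed by the vectors, here the logarithms,
        so the index \<open>j\<close> has to be recovered from its logarithm.\<close>
      define u where "u v = (of_int (int (count \<alpha> (the_inv_into ?T ?L v)) -
        int (count \<beta> (the_inv_into ?T ?L v))) :: rat)" for v
      have u: "u (?L j) = of_int (int (count \<alpha> j) - int (count \<beta> j))" if "j \<in> ?T" for j
        unfolding u_def by (simp only: the_inv_into_f_f[OF inj_T that])
      have "(\<Sum>v\<in>?L ` ?T. of_rat (u v) * v) = (\<Sum>j\<in>?T. of_rat (u (?L j)) * ?L j)"
        by (simp add: sum.reindex[OF inj_T])
      also have "\<dots> = (\<Sum>j\<in>?T. real (count \<alpha> j) * ?L j - real (count \<beta> j) * ?L j)"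
        by (intro sum.cong refl) (simp only: u of_rat_of_int_eq, simp add: algebra_simps)
      also have "\<dots> = ln (real (mult_value n \<alpha>)) - ln (real (mult_value n \<beta>))"
        using ln_mult_value[OF T(1) Un_upper1 pos] ln_mult_value[OF T(1) Un_upper2 pos]
        by (simp add: sum_subtractf)
      also have "\<dots> = 0"
        by (simp add: eq)
      finally have "u (?L j) = 0" if "j \<in> ?T" for j
        using independentD[OF indep, of "?L ` ?T" u "?L j"] T that by blast
      with u have on_T: "count \<alpha> j = count \<beta> j" if "j \<in> ?T" for j
        using that by (metis of_int_eq_0_iff eq_iff_diff_eq_0 of_nat_eq_iff)
      show "\<alpha> = \<beta>"
      proof (rule multiset_eqI)
        show "count \<alpha> j = count \<beta> j" for j
        proof (cases "j \<in> ?T")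
          case False
          then show ?thesis
            by (metis UnI1 UnI2 not_in_iff)
        qed (rule on_T)
      qed
    qed
  next
    assume inj: ?inj
    show ?indep
    proof
      assume "dependent (?L ` J)"
      then obtain t u where t: "finite t" "t \<subseteq> ?L ` J" "(\<Sum>v\<in>t. of_rat (u v) * v) = 0"
        and nonzero: "\<exists>v\<in>t. u v \<noteq> 0"
        unfolding dependent_explicit by blast
      obtain T where T: "finite T" "T \<subseteq> J" "t = ?L ` T"
        using finite_subset_image[OF t(1,2)] by blast
      have inj_T: "inj_on ?L T"
        using inj_L T(2) by (rule inj_on_subset)
      obtain D :: int and m :: "nat \<Rightarrow> int"
        where D: "D > 0" and m: "\<And>j. j \<in> T \<Longrightarrow> of_int (m j) = of_int D * u (?L j)"
        using common_denominator[OF T(1), of "\<lambda>j. u (?L j)"] by blast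
      \<comment> \<open>Since \<open>nat\<close> sends negative integers to 0,
        \<open>\<alpha>\<close> and \<open>\<beta>\<close> carry the positive and the negative part
        of \<open>m\<close>.\<close>
      define \<alpha> where "\<alpha> = (\<Sum>j\<in>T. replicate_mset (nat (m j)) j)"
      define \<beta> where "\<beta> = (\<Sum>j\<in>T. replicate_mset (nat (- m j)) j)"
      have count: "count \<alpha> j = (if j \<in> T then nat (m j) else 0)"
        "count \<beta> j = (if j \<in> T then nat (- m j) else 0)" for j
        unfolding \<alpha>_def \<beta>_def by (rule count_sum_replicate[OF T(1)])+
      have sub: "set_mset \<alpha> \<subseteq> T" "set_mset \<beta> \<subseteq> T"
        using count by (metis count_eq_zero_iff subsetI)+
      have pos: "0 < n j" if "j \<in> T" for j
        using n T(2) that by blast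
      have "ln (real (mult_value n \<alpha>)) - ln (real (mult_value n \<beta>)) =
          (\<Sum>j\<in>T. real (count \<alpha> j) * ?L j - real (count \<beta> j) * ?L j)"
        using ln_mult_value[OF T(1) sub(1) pos] ln_mult_value[OF T(1) sub(2) pos]
        by (simp add: sum_subtractf)
      also have "\<dots> = (\<Sum>j\<in>T. of_int D * (of_rat (u (?L j)) * ?L j))"
      proof (intro sum.cong refl)
        fix j assume j: "j \<in> T"
        have "real (count \<alpha> j) - real (count \<beta> j) = of_int (m j)"
          using j by (auto simp: count)
        also have "\<dots> = of_rat (of_int (m j))"
          by simp
        also have "\<dots> = of_int D * of_rat (u (?L j))"
          by (simp only: m[OF j] of_rat_mult of_rat_of_int_eq)
        finally show "real (count \<alpha> j) * ?L j - real (count \<beta> j) * ?L j =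
            of_int D * (of_rat (u (?L j)) * ?L j)"
          by (metis left_diff_distrib mult.assoc)
      qed
      also have "\<dots> = of_int D * (\<Sum>v\<in>t. of_rat (u v) * v)"
        unfolding T(3) by (simp add: sum.reindex[OF inj_T] sum_distrib_left)
      also have "\<dots> = 0"
        by (simp add: t(3))
      finally have "ln (real (mult_value n \<alpha>)) = ln (real (mult_value n \<beta>))"
        by simp
      moreover have "0 < mult_value n \<alpha>" "0 < mult_value n \<beta>"
        using sub pos by (auto intro!: mult_value_pos)
      ultimately have "mult_value n \<alpha> = mult_value n \<beta>"
        by simp
      then have "\<alpha> = \<beta>"
        using sub T(2) by (intro inj_onD[OF inj]) auto
      then have "m j = 0" if "j \<in> T" for j
        using count[of j] that by simp
      then have "u (?L j) = 0" if "j \<in> T" for j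
        using m[OF that] D that by simp
      with nonzero T(3) show False
        by blast
    qed
  qed
qed

subsection \<open>The multiplier variety\<close>

text \<open>Integer translations to the right produce exactly the points at which
  \<open>monomial_expansion_zero\<close> tests an expansion.\<close>

lemma embedding_of_real_add:
  assumes "\<And>j. j \<in> index_set d \<Longrightarrow> 0 < n j"
  shows "embedding d b n (of_real x + of_nat k) =
         (\<lambda>j. embedding d b n (of_real x) j / of_nat (n j) ^ k)"
proof
  fix j
  show "embedding d b n (of_real x + of_nat k) j = embedding d b n (of_real x) j / of_nat (n j) ^ k"
  proof (cases "j \<in> index_set d")
    case True
    have "- (of_real x + of_nat k) = - complex_of_real x - of_nat k"
      by simp
    with True assms[OF True] show ?thesis
      by (simp add: embedding_def powr_diff)
  qed (simp add: embedding_def)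
qed

lemma embedding_mem_unit_ball:
  assumes "weight_frequency_data d b n" "admissible_abscissa d b n \<rho>" "s \<in> half_plane \<rho>"
  shows "embedding d b n s \<in> unit_ball d"
proof -
  have sq: "(cmod (embedding d b n s j))\<^sup>2 = b j * real (n j) powr (- 2 * Re s)" if j: "j \<in> index_set d" for j
  proof -
    have "0 < b j" "2 \<le> n j"
      using assms(1) j by (auto simp: weight_frequency_data_def)
    then have "cmod (embedding d b n s j) = sqrt (b j) * real (n j) powr (- Re s)"
      using j by (simp add: embedding_def norm_mult norm_powr_real_powr)
    moreover have "(real (n j) powr (- Re s))\<^sup>2 = real (n j) powr (- 2 * Re s)"
      by (simp add: power2_eq_square flip: powr_add)
    ultimately show ?thesis
      using \<open>0 < b j\<close> by (simp add: power_mult_distrib)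
  qed
  have "(\<lambda>j. b j * real (n j) powr (- 2 * Re s)) summable_on index_set d"
    "(\<Sum>\<^sub>\<infinity>j\<in>index_set d. b j * real (n j) powr (- 2 * Re s)) < 1"
    using assms(2,3) by (auto simp: admissible_abscissa_def)
  then have "(\<lambda>j. (cmod (embedding d b n s j))\<^sup>2) summable_on index_set d"
    "(\<Sum>\<^sub>\<infinity>j\<in>index_set d. (cmod (embedding d b n s j))\<^sup>2) < 1"
    using summable_on_cong[of "index_set d", OF sq] infsum_cong[of "index_set d", OF sq] by simp_all
  then show ?thesis
    by (simp add: unit_ball_def complex_space_def embedding_def)
qed

lemma multiplier_variety_eq_unit_ball_if_inj:
  assumes data: "weight_frequency_data d b n" and \<rho>: "admissible_abscissa d b n \<rho>"
    and inj: "inj_on (mult_value n) (multi_indices d)"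
  shows "multiplier_variety d b n \<rho> = unit_ball d"
proof -
  have n: "0 < n j" and b: "0 < b j" if "j \<in> index_set d" for j
    using data that by (auto simp: weight_frequency_data_def dest: bspec)
  interpret E: feature_expansion "unit_ball d" "drury_arveson_kernel d" "multi_indices d" basis_monomial
    by (rule feature_expansion_drury_arveson)
  have "g z = 0" if g: "g \<in> drury_arveson_multipliers d"
    and zero: "\<forall>w\<in>embedding d b n ` half_plane \<rho>. g w = 0" for g z
  proof -
    obtain c where c: "c \<in> l2 (multi_indices d)" and gc: "g = E.synthesis c"
      using multiplier_mem_space[OF g] unfolding drury_arveson_space_eq E.space_def by blast
    \<comment> \<open>Any real base point to the right of \<open>\<rho>\<close> would do; its
      integer translates to the right stay in the half-plane.\<close>
    let ?p = "embedding d b n (of_real (\<rho> + 1))"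
    have "c = (\<lambda>\<alpha>. 0)"
    proof (rule monomial_expansion_zero[OF c _ _ n inj])
      show "?p \<in> unit_ball d"
        by (rule embedding_mem_unit_ball[OF data \<rho>]) (simp add: half_plane_def)
      show "?p j \<noteq> 0" if "j \<in> index_set d" for j
        using that n[OF that] b[OF that] by (simp add: embedding_def powr_def)
      fix k
      have mem: "of_real (\<rho> + 1) + of_nat k \<in> half_plane \<rho>"
        by (simp add: half_plane_def)
      have eq: "embedding d b n (of_real (\<rho> + 1) + of_nat k) = (\<lambda>j. ?p j / of_nat (n j) ^ k)"
        by (rule embedding_of_real_add[OF n])
      have "E.synthesis c (\<lambda>j. ?p j / of_nat (n j) ^ k) = 0"
        using zero mem gc unfolding eq[symmetric] by blast
      moreover have "(\<lambda>j. ?p j / of_nat (n j) ^ k) \<in> unit_ball d"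
        unfolding eq[symmetric] by (rule embedding_mem_unit_ball[OF data \<rho> mem])
      ultimately show "(\<Sum>\<^sub>\<infinity>\<alpha>\<in>multi_indices d. c \<alpha> * basis_monomial \<alpha> (\<lambda>j. ?p j / of_nat (n j) ^ k)) = 0"
        unfolding E.synthesis_def by simp
    qed
    then show ?thesis
      by (simp add: gc E.synthesis_def)
  qed
  then show ?thesis
    unfolding multiplier_variety_def by blast
qed

lemma prod_mset_embedding:
  assumes "set_mset \<alpha> \<subseteq> index_set d"
  shows "(\<Prod>j\<in>#\<alpha>. embedding d b n s j) =
           (\<Prod>j\<in>#\<alpha>. of_real (sqrt (b j))) * of_nat (mult_value n \<alpha>) powr (- s)"
  using assms
  by (induction \<alpha>) (auto simp: mult_value_def embedding_def powr_times_real)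

text \<open>On the image of the half-plane, two monomials with equal \<open>mult_value\<close>
  differ only by the constant factors coming from the weights. Dividing by these gives a binomial
  that vanishes there, hence on the whole ball, against uniqueness of coefficients.\<close>

lemma inj_if_multiplier_variety_eq_unit_ball:
  assumes data: "weight_frequency_data d b n"
    and variety: "multiplier_variety d b n \<rho> = unit_ball d"
  shows "inj_on (mult_value n) (multi_indices d)"
proof (rule inj_onI, rule ccontr)
  fix \<alpha> \<beta> assume \<alpha>: "\<alpha> \<in> multi_indices d" and \<beta>: "\<beta> \<in> multi_indices d"
    and eq: "mult_value n \<alpha> = mult_value n \<beta>" and neq: "\<alpha> \<noteq> \<beta>"
  interpret E: feature_expansion "unit_ball d" "drury_arveson_kernel d" "multi_indices d" basis_monomial
    by (rule feature_expansion_drury_arveson)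
  define B :: "nat multiset \<Rightarrow> complex" where "B \<gamma> = (\<Prod>j\<in>#\<gamma>. of_real (sqrt (b j)))" for \<gamma>
  define q :: "nat multiset \<Rightarrow> complex"
    where "q \<gamma> = of_real (sqrt (card (permutations_of_multiset \<gamma>)))" for \<gamma>
  have B: "B \<gamma> \<noteq> 0" if "\<gamma> \<in> multi_indices d" for \<gamma>
  proof -
    have "b j \<noteq> 0" if "j \<in> index_set d" for j
      using data that unfolding weight_frequency_data_def by force
    with that show ?thesis
      by (auto simp: B_def multi_indices_def)
  qed
  have q: "q \<gamma> \<noteq> 0" for \<gamma>
    using card_permutations_of_multiset_pos[of \<gamma>] by (simp add: q_def)
  define g where "g z = (if z \<in> unit_ball d
    then 1 / B \<alpha> * (\<Prod>j\<in>#\<alpha>. z j) + - (1 / B \<beta>) * (\<Prod>j\<in>#\<beta>. z j) else 0)" for z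
  have "g \<in> drury_arveson_multipliers d"
    unfolding g_def by (rule binomial_multiplier[OF \<alpha> \<beta>])
  \<comment> \<open>Outside the ball \<open>g\<close> is 0 by its definition, and inside the two
    terms cancel, so every \<open>s\<close> is covered.\<close>
  moreover have "g (embedding d b n s) = 0" for s
    using \<alpha> \<beta> B by (simp add: g_def prod_mset_embedding multi_indices_def eq flip: B_def)
  moreover have "z \<in> multiplier_variety d b n \<rho>" if "z \<in> unit_ball d" for z
    using that variety by simp
  ultimately have g0: "g z = 0" if "z \<in> unit_ball d" for z
    using that unfolding multiplier_variety_def by blast
  \<comment> \<open>These are the coefficients of \<open>g\<close> in the normalized basis; the
    factors \<open>q\<close> undo the normalization.\<close>
  define c where "c \<gamma> = (if \<gamma> = \<alpha> then 1 / (B \<alpha> * q \<alpha>) else if \<gamma> = \<beta> then - (1 / (B \<beta> * q \<beta>)) else 0)" for \<gamma>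
  have "finite {\<gamma> \<in> multi_indices d. (cmod (c \<gamma>))\<^sup>2 \<noteq> 0}"
    by (rule finite_subset[of _ "{\<alpha>, \<beta>}"]) (auto simp: c_def split: if_splits)
  then have c: "c \<in> l2 (multi_indices d)"
    using \<alpha> \<beta> by (auto simp: l2_def c_def intro: finite_nonzero_values_imp_summable_on)
  have "(\<Sum>\<^sub>\<infinity>\<gamma>\<in>multi_indices d. c \<gamma> * basis_monomial \<gamma> z) = 0" if z: "z \<in> unit_ball d" for z
  proof -
    have "(\<Sum>\<^sub>\<infinity>\<gamma>\<in>multi_indices d. c \<gamma> * basis_monomial \<gamma> z) = (\<Sum>\<^sub>\<infinity>\<gamma>\<in>{\<alpha>, \<beta>}. c \<gamma> * basis_monomial \<gamma> z)"
      using \<alpha> \<beta> by (intro infsum_cong_neutral) (auto simp: c_def)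
    also have "\<dots> = c \<alpha> * basis_monomial \<alpha> z + c \<beta> * basis_monomial \<beta> z"
      using neq by simp
    also have "\<dots> = g z"
      using neq z q by (simp add: g_def c_def basis_monomial_def flip: q_def)
    also have "\<dots> = 0"
      by (rule g0[OF z])
    finally show ?thesis .
  qed
  from E.expansion_unique[OF c this] have "c \<alpha> = 0"
    by (simp add: fun_eq_iff)
  with B[OF \<alpha>] q[of \<alpha>] show False
    by (simp add: c_def)
qed

theorem theorem4p2:
  fixes d :: enat and b :: "nat \<Rightarrow> real" and n :: "nat \<Rightarrow> nat" and \<rho> :: real
  assumes "2 \<le> d"
    and "weight_frequency_data d b n"
    and "admissible_abscissa d b n \<rho>"
  shows "multiplier_variety d b n \<rho> = unit_ball d \<longleftrightarrow>
         module.independent (\<lambda>(q::rat) (x::real). of_rat q * x)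
           ((\<lambda>j. ln (real (n j))) ` index_set d)"
proof -
  have "module.independent (\<lambda>(q::rat) (x::real). of_rat q * x)
      ((\<lambda>j. ln (real (n j))) ` index_set d) \<longleftrightarrow> inj_on (mult_value n) (multi_indices d)"
    unfolding multi_indices_def
    using assms(2) by (intro independent_ln_iff) (auto simp: weight_frequency_data_def dest: bspec)
  with assms(2,3) show ?thesis
    using multiplier_variety_eq_unit_ball_if_inj inj_if_multiplier_variety_eq_unit_ball by blast
qed

end
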